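(* Let $X$ and $Y$ be separable Banach spaces. Suppose $i:Y\to X$ is a bounded, injective linear map with dense image and $M\subset X$ is a smooth, closed submanifold of finite codimension. Then $N=i^{-1}(M)$ is a smooth closed submanifold of $Y$, and the restrictions $i:Y\setminus N\to X\setminus M$ and $i:(Y,N)\to(X,M)$ are homotopy equivalences (the latter as a map of pairs).
   Context: Banach spaces are real; a closed submanifold is a submanifold which is a closed subset. *)

theory Defs
  imports "HOL-Analysis.Analysis"
begin

section \<open>Smooth maps between normed spaces\<close>

text \<open>A \<open>k\<close>-linear map is a function on lists, of which only the values on lists of length \<open>k\<close>
  matter.  The constant \<open>C\<close> below bounds its operator norm.\<close>

definition bounded_multilinear ::
  "nat \<Rightarrow> ('a::real_normed_vector list \<Rightarrow> 'b::real_normed_vector) \<Rightarrow> bool" where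
  "bounded_multilinear k m \<longleftrightarrow>
     (\<forall>us vs. length us + 1 + length vs = k \<longrightarrow> linear (\<lambda>v. m (us @ v # vs))) \<and>
     (\<exists>C. \<forall>vs. length vs = k \<longrightarrow> norm (m vs) \<le> C * prod_list (map norm vs))"

text \<open>The iterated Frechet derivatives of \<open>f\<close> live in \<open>L(X, L(X, \<dots>, Y))\<close>, a type that depends on the
  order.  As usual these spaces are identified with the spaces of bounded multilinear maps, so
  \<open>D k x [v\<^sub>1, \<dots>, v\<^sub>k]\<close> is the \<open>k\<close>-th derivative at \<open>x\<close>.  The last clause says that \<open>D (Suc k) x\<close> is
  the Frechet derivative of \<open>D k\<close> at \<open>x\<close> for the operator norm on \<open>k\<close>-linear maps; the new direction
  is the head of the list.  Continuity of every \<open>D k\<close> follows from its differentiability.\<close>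

definition smooth_on ::
  "'a::real_normed_vector set \<Rightarrow> ('a \<Rightarrow> 'b::real_normed_vector) \<Rightarrow> bool" where
  "smooth_on U f \<longleftrightarrow>
     (\<exists>D :: nat \<Rightarrow> 'a \<Rightarrow> 'a list \<Rightarrow> 'b.
        (\<forall>x\<in>U. D 0 x [] = f x) \<and>
        (\<forall>k. \<forall>x\<in>U. bounded_multilinear k (D k x)) \<and>
        (\<forall>k. \<forall>x\<in>U. \<forall>e>0. \<forall>\<^sub>F y in at x within U. \<forall>vs. length vs = k \<longrightarrow>
           norm (D k y vs - D k x vs - D (Suc k) x ((y - x) # vs))
             \<le> e * norm (y - x) * prod_list (map norm vs)))"

definition smooth_diffeomorphism ::
  "'a::real_normed_vector set \<Rightarrow> 'b::real_normed_vector set \<Rightarrow> ('a \<Rightarrow> 'b) \<Rightarrow> bool" where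
  "smooth_diffeomorphism U V \<phi> \<longleftrightarrow>
     bij_betw \<phi> U V \<and> smooth_on U \<phi> \<and> smooth_on V (inv_into U \<phi>)"

section \<open>Submanifolds of Banach spaces\<close>

definition complemented_subspace :: "'a::real_normed_vector set \<Rightarrow> bool" where
  "complemented_subspace E \<longleftrightarrow> subspace E \<and> closed E \<and>
     (\<exists>F. subspace F \<and> closed F \<and> E \<inter> F = {0} \<and> (\<forall>x. \<exists>u\<in>E. \<exists>v\<in>F. x = u + v))"

text \<open>Here the complement may be taken to be the span of a finite set; it is then automatically
  closed, so a closed subspace of finite codimension is complemented.\<close>

definition finite_codim_subspace :: "'a::real_normed_vector set \<Rightarrow> bool" where
  "finite_codim_subspace E \<longleftrightarrow> subspace E \<and> closed E \<and> (\<exists>B. finite B \<and> span (E \<union> B) = UNIV)"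

text \<open>A chart of the ambient space around \<open>p\<close> that straightens \<open>M\<close> to the subspace \<open>E\<close>.  As \<open>E\<close> will be
  complemented, the chart may take values in the ambient space itself instead of \<open>E \<times> F\<close>.\<close>

definition slice_chart_at ::
  "'a::real_normed_vector set \<Rightarrow> 'a set \<Rightarrow> 'a \<Rightarrow> bool" where
  "slice_chart_at M E p \<longleftrightarrow>
     (\<exists>U V \<phi>. open U \<and> p \<in> U \<and> open V \<and> smooth_diffeomorphism U V \<phi> \<and> \<phi> ` (U \<inter> M) = V \<inter> E)"

definition smooth_submanifold :: "'a::real_normed_vector set \<Rightarrow> bool" where
  "smooth_submanifold M \<longleftrightarrow> (\<forall>p\<in>M. \<exists>E. complemented_subspace E \<and> slice_chart_at M E p)"

text \<open>The codimension may differ from one connected component of \<open>M\<close> to another.\<close>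

definition finite_codim_smooth_submanifold :: "'a::real_normed_vector set \<Rightarrow> bool" where
  "finite_codim_smooth_submanifold M \<longleftrightarrow>
     (\<forall>p\<in>M. \<exists>E. finite_codim_subspace E \<and> slice_chart_at M E p)"

section \<open>Homotopy equivalences\<close>

definition homotopy_equivalence :: "'a topology \<Rightarrow> 'b topology \<Rightarrow> ('a \<Rightarrow> 'b) \<Rightarrow> bool" where
  "homotopy_equivalence X Y f \<longleftrightarrow> continuous_map X Y f \<and>
     (\<exists>g. continuous_map Y X g \<and>
          homotopic_with (\<lambda>_. True) X X (g \<circ> f) id \<and>
          homotopic_with (\<lambda>_. True) Y Y (f \<circ> g) id)"

text \<open>All maps and homotopies are maps of pairs; in particular every stage of the two homotopies
  preserves the subspace.\<close>

definition homotopy_equivalence_pairs ::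
  "'a topology \<Rightarrow> 'a set \<Rightarrow> 'b topology \<Rightarrow> 'b set \<Rightarrow> ('a \<Rightarrow> 'b) \<Rightarrow> bool" where
  "homotopy_equivalence_pairs X A Y B f \<longleftrightarrow> continuous_map X Y f \<and> f ` A \<subseteq> B \<and>
     (\<exists>g. continuous_map Y X g \<and> g ` B \<subseteq> A \<and>
          homotopic_with (\<lambda>h. h ` A \<subseteq> A) X X (g \<circ> f) id \<and>
          homotopic_with (\<lambda>h. h ` B \<subseteq> B) Y Y (f \<circ> g) id)"

end

theory Submission
  imports Defs
begin

text \<open>The inverse of \<open>i\<close> on its range is in general unbounded, so a point of X
  can be approximated from Y but not lifted to Y continuously by a linear map. Hence every
  correction near \<open>M\<close> has to be given by a vector of Y from the start: this is why
  \<open>T\<close>, \<open>\<tau>\<close> and \<open>\<sigma>\<close> take values in Y. A homotopy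
  in X built from \<open>i (g x)\<close>, \<open>x\<close> and \<open>i (\<sigma> x)\<close> then
  lifts along \<open>i\<close> to Y, and one membership check in X serves both spaces. Local
  corrections are composed, not averaged, because convex combinations of points of \<open>M\<close>
  need not lie in \<open>M\<close>. The charts are normalised to have derivative \<open>id\<close>
  at the point so that an inverse function theorem for \<open>x + h x\<close>, with the derivative
  of \<open>h\<close> bounded by 1/2, suffices; its delicate part is smoothness of all orders in the
  operator norm.\<close>

text \<open>Around a point of \<open>M\<close> a chart \<open>\<phi>\<close> with derivative \<open>\<Lambda>\<close> straightens \<open>M\<close> to a closed subspace \<open>E\<close> of
  finite codimension.  As \<open>\<Lambda> \<circ> i\<close> has dense range, directions transversal to \<open>E\<close> can be chosen in
  \<open>i Y\<close>: there is a bounded \<open>T : X \<rightarrow> Y\<close> with kernel \<open>E\<close> and \<open>T \<circ> \<Lambda> \<circ> i \<circ> T = T\<close>.  The map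
  \<open>y \<mapsto> y + T \<phi>(i y) - T \<Lambda> i y\<close> has derivative \<open>id\<close> and is a slice chart of \<open>N\<close>.  The same
  construction in \<open>X\<close> yields local retractions onto \<open>M\<close> of the form \<open>x \<mapsto> x + i (\<tau> x)\<close> with \<open>\<tau>\<close>
  continuous into \<open>Y\<close>; composing countably many of them, suitably cut off, gives a continuous
  \<open>\<sigma> : X \<rightarrow> Y\<close> that vanishes on \<open>M\<close> and satisfies \<open>x + i (\<sigma> x) \<in> M\<close> near \<open>M\<close>.  Finally there are
  continuous \<open>g\<close> into \<open>Y\<close> with \<open>i (g x)\<close> as close to \<open>x\<close> as desired.  Then \<open>g\<close> is a homotopy inverse
  for the complements, and \<open>x \<mapsto> g x + \<sigma> (i (g x))\<close> is one for the pairs; all homotopies are straight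
  lines, corrected by \<open>\<sigma>\<close> in the case of pairs.\<close>

section \<open>Bounded multilinear maps\<close>

lemma prod_list_norm_nonneg [simp]: "prod_list (map norm (vs :: 'a::real_normed_vector list)) \<ge> 0"
  by (induction vs) auto

lemma prod_list_norm_permute:
  assumes "distinct js" "set js = {..<length vs}"
  shows "prod_list (map norm (map ((!) vs) js)) = prod_list (map norm (vs :: 'a::real_normed_vector list))"
proof -
  have "mset js = mset [0..<length vs]"
    using assms by (subst set_eq_iff_mset_eq_distinct[symmetric]) (auto simp: atLeast0LessThan)
  then have "mset (map norm (map ((!) vs) js)) = mset (map norm (map ((!) vs) [0..<length vs]))"
    by (simp only: mset_map)
  then have "mset (map norm (map ((!) vs) js)) = mset (map norm vs)"
    by (simp only: map_nth)
  then show ?thesis by (simp only: prod_mset_prod_list[symmetric])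
qed

lemma bounded_multilinear_bound:
  assumes "bounded_multilinear k m"
  obtains C where "C > 0" "\<And>vs. length vs = k \<Longrightarrow> norm (m vs) \<le> C * prod_list (map norm vs)"
proof -
  obtain C where C: "\<And>vs. length vs = k \<Longrightarrow> norm (m vs) \<le> C * prod_list (map norm vs)"
    using assms unfolding bounded_multilinear_def by blast
  show ?thesis
  proof (rule that[of "max C 1"])
    show "norm (m vs) \<le> max C 1 * prod_list (map norm vs)" if "length vs = k" for vs
      using C[OF that] mult_right_mono[of C "max C 1" "prod_list (map norm vs)"] by simp
  qed simp
qed

lemma bounded_multilinearI:
  assumes "\<And>us vs. length us + 1 + length vs = k \<Longrightarrow> linear (\<lambda>v. m (us @ v # vs))"
    and "\<And>vs. length vs = k \<Longrightarrow> norm (m vs) \<le> C * prod_list (map norm vs)"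
  shows "bounded_multilinear k m"
  using assms unfolding bounded_multilinear_def by blast

lemma bounded_multilinear_linear:
  "bounded_multilinear k m \<Longrightarrow> length us + 1 + length vs = k \<Longrightarrow> linear (\<lambda>v. m (us @ v # vs))"
  unfolding bounded_multilinear_def by blast

lemma bounded_multilinear_head:
  assumes "bounded_multilinear (Suc k) m" "length vs = k"
  shows "bounded_linear (\<lambda>v. m (v # vs))"
proof -
  obtain C where C: "C > 0" "\<And>vs. length vs = Suc k \<Longrightarrow> norm (m vs) \<le> C * prod_list (map norm vs)"
    using bounded_multilinear_bound[OF assms(1)] by metis
  have "linear (\<lambda>v. m (v # vs))"
    using bounded_multilinear_linear[OF assms(1), of "[]" vs] assms(2) by simp
  moreover have "norm (m (v # vs)) \<le> norm v * (C * prod_list (map norm vs))" for v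
    using C(2)[of "v # vs"] assms(2) by (simp add: mult_ac)
  ultimately show ?thesis
    unfolding bounded_linear_def bounded_linear_axioms_def by blast
qed

lemma bounded_multilinear_cong:
  assumes "bounded_multilinear k m" "\<And>vs. length vs = k \<Longrightarrow> m vs = m' vs"
  shows "bounded_multilinear k m'"
proof -
  obtain C where C: "\<And>vs. length vs = k \<Longrightarrow> norm (m vs) \<le> C * prod_list (map norm vs)"
    using bounded_multilinear_bound[OF assms(1)] by metis
  show ?thesis
  proof (rule bounded_multilinearI[where C=C])
    fix us vs :: "'a list" assume l: "length us + 1 + length vs = k"
    then have "(\<lambda>v. m' (us @ v # vs)) = (\<lambda>v. m (us @ v # vs))" using assms(2) by auto
    then show "linear (\<lambda>v. m' (us @ v # vs))" using bounded_multilinear_linear[OF assms(1) l] by simp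
  qed (use C assms(2) in auto)
qed

lemma bounded_multilinear_add:
  assumes "bounded_multilinear k m" "bounded_multilinear k m'"
  shows "bounded_multilinear k (\<lambda>vs. m vs + m' vs)"
proof -
  obtain C where C: "\<And>vs. length vs = k \<Longrightarrow> norm (m vs) \<le> C * prod_list (map norm vs)"
    using bounded_multilinear_bound[OF assms(1)] by metis
  obtain C' where C': "\<And>vs. length vs = k \<Longrightarrow> norm (m' vs) \<le> C' * prod_list (map norm vs)"
    using bounded_multilinear_bound[OF assms(2)] by metis
  show ?thesis
  proof (rule bounded_multilinearI[where C="C + C'"])
    fix us vs :: "'a list" assume l: "length us + 1 + length vs = k"
    show "linear (\<lambda>v. m (us @ v # vs) + m' (us @ v # vs))"
      using bounded_multilinear_linear[OF assms(1) l] bounded_multilinear_linear[OF assms(2) l]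
      by (rule linear_compose_add)
  next
    fix vs :: "'a list" assume "length vs = k"
    then show "norm (m vs + m' vs) \<le> (C + C') * prod_list (map norm vs)"
      using C[of vs] C'[of vs] norm_triangle_ineq[of "m vs" "m' vs"] by (simp add: distrib_right)
  qed
qed

lemma prod_list_norm_map_le:
  assumes "\<And>v. norm (f v) \<le> norm v * C" "C \<ge> 0"
  shows "prod_list (map norm (map f vs)) \<le> C ^ length vs * prod_list (map norm vs)"
proof (induction vs)
  case (Cons v vs)
  have "norm (f v) * prod_list (map norm (map f vs)) \<le> (norm v * C) * (C ^ length vs * prod_list (map norm vs))"
    by (intro mult_mono Cons.IH assms prod_list_norm_nonneg) (auto intro!: mult_nonneg_nonneg assms)
  then show ?case by (simp add: mult_ac)
qed simp

lemma bounded_multilinear_compose_linear: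
  assumes m: "bounded_multilinear k m" and T: "bounded_linear T" and j: "bounded_linear j"
  shows "bounded_multilinear k (\<lambda>vs. T (m (map j vs)))"
proof -
  obtain C where C: "C > 0" "\<And>vs. length vs = k \<Longrightarrow> norm (m vs) \<le> C * prod_list (map norm vs)"
    using bounded_multilinear_bound[OF m] by metis
  obtain CT where CT: "CT > 0" "\<And>v. norm (T v) \<le> norm v * CT"
    using bounded_linear.pos_bounded[OF T] by blast
  obtain Cj where Cj: "Cj > 0" "\<And>v. norm (j v) \<le> norm v * Cj"
    using bounded_linear.pos_bounded[OF j] by blast
  show ?thesis
  proof (rule bounded_multilinearI[where C="CT * C * Cj ^ k"])
    fix us vs :: "'d list" assume "length us + 1 + length vs = k"
    then have "linear (\<lambda>v. m (map j us @ v # map j vs))"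
      by (intro bounded_multilinear_linear[OF m]) simp
    from linear_compose[OF linear_compose[OF bounded_linear.linear[OF j] this] bounded_linear.linear[OF T]]
    show "linear (\<lambda>v. T (m (map j (us @ v # vs))))" by (simp add: o_def)
  next
    fix vs :: "'d list" assume l: "length vs = k"
    have "norm (T (m (map j vs))) \<le> norm (m (map j vs)) * CT" by (rule CT)
    also have "\<dots> \<le> (C * prod_list (map norm (map j vs))) * CT"
      using C(2)[of "map j vs"] l CT(1) by (intro mult_right_mono) auto
    also have "\<dots> \<le> (C * (Cj ^ k * prod_list (map norm vs))) * CT"
      using prod_list_norm_map_le[of j Cj vs] Cj l CT(1) C(1)
      by (intro mult_right_mono mult_left_mono) auto
    finally show "norm (T (m (map j vs))) \<le> CT * C * Cj ^ k * prod_list (map norm vs)" by (simp add: mult_ac)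
  qed
qed

lemma bounded_multilinear_permute:
  assumes m: "bounded_multilinear k m" and js: "distinct js" "set js = {..<k}"
  shows "bounded_multilinear k (\<lambda>vs. m (map ((!) vs) js))"
proof -
  obtain C where C: "C > 0" "\<And>vs. length vs = k \<Longrightarrow> norm (m vs) \<le> C * prod_list (map norm vs)"
    using bounded_multilinear_bound[OF m] by metis
  have len: "length js = k" using js by (metis card_lessThan distinct_card)
  show ?thesis
  proof (rule bounded_multilinearI[where C=C])
    fix us vs :: "'a list" assume l: "length us + 1 + length vs = k"
    then have "length us \<in> set js" using js by simp
    \<comment> \<open>As \<open>js\<close> is distinct, \<open>v\<close> fills exactly one slot of
      the permuted list and the other slots do not depend on it.\<close>
    then obtain js1 js2 where eq: "js = js1 @ length us # js2" by (meson split_list)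
    have *: "map ((!) (us @ v # vs)) xs = map ((!) (us @ 0 # vs)) xs" if "length us \<notin> set xs" for xs v
      using that by (intro map_cong refl) (auto simp: nth_append nth_Cons split: nat.split)
    have "map ((!) (us @ v # vs)) js = map ((!) (us @ 0 # vs)) js1 @ v # map ((!) (us @ 0 # vs)) js2" for v
    proof -
      have n: "length us \<notin> set js1" "length us \<notin> set js2" using js(1) by (auto simp: eq)
      show ?thesis unfolding eq map_append list.map *[OF n(1), of v] *[OF n(2), of v] by simp
    qed
    moreover have "length js1 + 1 + length js2 = k" using len by (simp add: eq)
    then have "linear (\<lambda>v. m (map ((!) (us @ 0 # vs)) js1 @ v # map ((!) (us @ 0 # vs)) js2))"
      by (intro bounded_multilinear_linear[OF m]) simp
    ultimately show "linear (\<lambda>v. m (map ((!) (us @ v # vs)) js))" by presburger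
  next
    fix vs :: "'a list" assume "length vs = k"
    then show "norm (m (map ((!) vs) js)) \<le> C * prod_list (map norm vs)"
      using C(2)[of "map ((!) vs) js"] prod_list_norm_permute[of js vs] js len by simp
  qed
qed

lemma prod_list_norm_take_drop:
  "prod_list (map norm (take p vs)) * prod_list (map norm (drop p vs)) = prod_list (map norm (vs :: 'a::real_normed_vector list))"
  by (metis append_take_drop_id map_append prod_list.append)

text \<open>Common building block of the product and chain rules: \<open>L\<close> consumes the
  first \<open>p\<close> arguments and its value fills the head slot of \<open>G\<close>.\<close>

lemma bounded_multilinear_plug:
  assumes G: "bounded_multilinear (Suc m) G" and L: "bounded_multilinear p L"
  shows "bounded_multilinear (p + m) (\<lambda>vs. G (L (take p vs) # drop p vs))"
proof -
  obtain C where C: "C > 0" "\<And>vs. length vs = Suc m \<Longrightarrow> norm (G vs) \<le> C * prod_list (map norm vs)"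
    using bounded_multilinear_bound[OF G] by metis
  obtain C' where C': "C' > 0" "\<And>vs. length vs = p \<Longrightarrow> norm (L vs) \<le> C' * prod_list (map norm vs)"
    using bounded_multilinear_bound[OF L] by metis
  show ?thesis
  proof (rule bounded_multilinearI[where C="C * C'"])
    fix us vs :: "'a list" assume l: "length us + 1 + length vs = p + m"
    show "linear (\<lambda>v. G (L (take p (us @ v # vs)) # drop p (us @ v # vs)))"
    \<comment> \<open>The varying argument is either consumed by \<open>L\<close> or passed to
      \<open>G\<close> directly.\<close>
    proof (cases "length us < p")
      case True
      then obtain q where q: "p - length us = Suc q" by (metis Suc_diff_Suc)
      have "linear (\<lambda>w. G ([] @ w # drop q vs))" 
        using l True q by (intro bounded_multilinear_linear[OF G]) auto
      moreover have "linear (\<lambda>v. L (us @ v # take q vs))"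
        using l True q by (intro bounded_multilinear_linear[OF L]) auto
      ultimately have "linear ((\<lambda>w. G ([] @ w # drop q vs)) \<circ> (\<lambda>v. L (us @ v # take q vs)))"
        using linear_compose by blast
      then show ?thesis using True q by (simp add: o_def)
    next
      case False
      then have "linear (\<lambda>v. G ((L (take p us) # drop p us) @ v # vs))"
        using l by (intro bounded_multilinear_linear[OF G]) auto
      then show ?thesis using False by simp
    qed
  next
    fix vs :: "'a list" assume l: "length vs = p + m"
    have "norm (G (L (take p vs) # drop p vs)) \<le> C * (norm (L (take p vs)) * prod_list (map norm (drop p vs)))"
      using C(2)[of "L (take p vs) # drop p vs"] l by simp
    also have "\<dots> \<le> C * ((C' * prod_list (map norm (take p vs))) * prod_list (map norm (drop p vs)))"
      using C(1) C'(2)[of "take p vs"] l by (intro mult_left_mono mult_right_mono) auto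
    finally show "norm (G (L (take p vs) # drop p vs)) \<le> C * C' * prod_list (map norm vs)"
      using prod_list_norm_take_drop[of p vs] by (simp add: mult_ac)
  qed
qed

section \<open>Multilinear-valued smooth maps\<close>

text \<open>Derivatives of maps with values in the \<open>m\<close>-linear maps are again functions on lists.  So
  induction on the order of differentiability does not change types, as it would for derivatives
  with values in spaces of operators.\<close>

definition multi_deriv ::
  "'a::real_normed_vector set \<Rightarrow> nat \<Rightarrow> ('a \<Rightarrow> 'a list \<Rightarrow> 'b::real_normed_vector) \<Rightarrow> ('a \<Rightarrow> 'a list \<Rightarrow> 'b) \<Rightarrow> bool" where
  "multi_deriv U m F F' \<longleftrightarrow>
     (\<forall>x\<in>U. \<forall>e>0. \<exists>d>0. \<forall>y\<in>U. dist y x < d \<longrightarrow> (\<forall>vs. length vs = m \<longrightarrow>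
        norm (F y vs - F x vs - F' x ((y - x) # vs)) \<le> e * norm (y - x) * prod_list (map norm vs)))"

text \<open>The arity is bound after the order because it grows with each derivative. The witness
  \<open>F'\<close> may depend on the order, which suits inductions;
  \<open>smooth_multi_deriv\<close> removes this dependence.\<close>

primrec smooth_upto ::
  "'a::real_normed_vector set \<Rightarrow> nat \<Rightarrow> nat \<Rightarrow> ('a \<Rightarrow> 'a list \<Rightarrow> 'b::real_normed_vector) \<Rightarrow> bool" where
  "smooth_upto U 0 = (\<lambda>m F. \<forall>x\<in>U. bounded_multilinear m (F x))"
| "smooth_upto U (Suc n) = (\<lambda>m F. (\<forall>x\<in>U. bounded_multilinear m (F x)) \<and>
     (\<exists>F'. multi_deriv U m F F' \<and> smooth_upto U n (Suc m) F'))"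

definition smooth_multi ::
  "'a::real_normed_vector set \<Rightarrow> nat \<Rightarrow> ('a \<Rightarrow> 'a list \<Rightarrow> 'b::real_normed_vector) \<Rightarrow> bool" where
  "smooth_multi U m F \<longleftrightarrow> (\<forall>n. smooth_upto U n m F)"

lemma smooth_upto_multilinear: "smooth_upto U n m F \<Longrightarrow> x \<in> U \<Longrightarrow> bounded_multilinear m (F x)"
  by (cases n) auto

lemma multi_derivD:
  assumes "multi_deriv U m F F'" "x \<in> U" "e > 0"
  obtains d where "d > 0" "\<And>y vs. y \<in> U \<Longrightarrow> dist y x < d \<Longrightarrow> length vs = m \<Longrightarrow>
        norm (F y vs - F x vs - F' x ((y - x) # vs)) \<le> e * norm (y - x) * prod_list (map norm vs)"
  using assms unfolding multi_deriv_def by meson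

lemma multi_deriv_cong:
  assumes "multi_deriv U m F F'"
    and "\<And>x vs. x \<in> U \<Longrightarrow> length vs = m \<Longrightarrow> F x vs = G x vs"
    and "\<And>x vs. x \<in> U \<Longrightarrow> length vs = Suc m \<Longrightarrow> F' x vs = G' x vs"
  shows "multi_deriv U m G G'"
  using assms(1) unfolding multi_deriv_def by (simp add: assms(2,3) cong: conj_cong imp_cong)

lemma smooth_upto_cong:
  assumes "smooth_upto U n m F" "\<And>x vs. x \<in> U \<Longrightarrow> length vs = m \<Longrightarrow> F x vs = G x vs"
  shows "smooth_upto U n m G"
proof -
  have bml: "\<forall>x\<in>U. bounded_multilinear m (G x)"
    using smooth_upto_multilinear[OF assms(1)] bounded_multilinear_cong assms(2) by metis
  show ?thesis
  proof (cases n)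
    case (Suc k)
    then obtain F' where "multi_deriv U m F F'" "smooth_upto U k (Suc m) F'" using assms(1) by auto
    moreover have "multi_deriv U m G F'" by (rule multi_deriv_cong[OF \<open>multi_deriv U m F F'\<close>]) (auto simp: assms(2))
    ultimately show ?thesis using Suc bml by auto
  qed (use bml in simp)
qed

lemma smooth_upto_Suc: "smooth_upto U (Suc n) m F \<Longrightarrow> smooth_upto U n m F"
proof (induction n arbitrary: m F)
  case (Suc n)
  obtain F' where "\<forall>x\<in>U. bounded_multilinear m (F x)" "multi_deriv U m F F'" "smooth_upto U (Suc n) (Suc m) F'"
    using Suc.prems unfolding smooth_upto.simps(2)[of U "Suc n"] by blast
  with Suc.IH[of "Suc m" F'] show ?case unfolding smooth_upto.simps(2)[of U n] by blast
qed auto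

text \<open>The remainder with tolerance 1 and a bound for \<open>F' x\<close> add up to a Lipschitz
  estimate at \<open>x\<close> that is uniform in the arguments.\<close>

lemma multi_deriv_lipschitz:
  assumes F: "multi_deriv U m F F'" and x: "x \<in> U" and F': "bounded_multilinear (Suc m) (F' x)"
  obtains C d where "C > 0" "d > 0" "\<And>y vs. y \<in> U \<Longrightarrow> dist y x < d \<Longrightarrow> length vs = m \<Longrightarrow>
        norm (F y vs - F x vs) \<le> C * norm (y - x) * prod_list (map norm vs)"
proof -
  obtain C where C: "C > 0" "\<And>vs. length vs = Suc m \<Longrightarrow> norm (F' x vs) \<le> C * prod_list (map norm vs)"
    using bounded_multilinear_bound[OF F'] by metis
  obtain d where d: "d > 0" "\<And>y vs. y \<in> U \<Longrightarrow> dist y x < d \<Longrightarrow> length vs = m \<Longrightarrow>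
        norm (F y vs - F x vs - F' x ((y - x) # vs)) \<le> 1 * norm (y - x) * prod_list (map norm vs)"
    using multi_derivD[OF F x zero_less_one] by metis
  show ?thesis
  proof (rule that[of "1 + C" d])
    fix y and vs :: "'a list" assume y: "y \<in> U" "dist y x < d" and vs: "length vs = m"
    have "norm (F y vs - F x vs) \<le> norm (F y vs - F x vs - F' x ((y - x) # vs)) + norm (F' x ((y - x) # vs))"
      using norm_triangle_ineq[of "F y vs - F x vs - F' x ((y - x) # vs)" "F' x ((y - x) # vs)"] by simp
    also have "\<dots> \<le> 1 * norm (y - x) * prod_list (map norm vs) + C * (norm (y - x) * prod_list (map norm vs))"
      using d(2)[OF y vs] C(2)[of "(y - x) # vs"] vs by simp
    finally show "norm (F y vs - F x vs) \<le> (1 + C) * norm (y - x) * prod_list (map norm vs)"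
      by (simp add: algebra_simps)
  qed (use C d in auto)
qed

text \<open>Freezing the arguments gives an ordinary Frechet derivative at an interior point, where
  derivatives are unique.\<close>

lemma multi_deriv_has_derivative:
  assumes F: "multi_deriv U m F F'" and U: "open U" "x \<in> U" and F': "bounded_multilinear (Suc m) (F' x)" and vs: "length vs = m"
  shows "((\<lambda>y. F y vs) has_derivative (\<lambda>v. F' x (v # vs))) (at x)"
  unfolding has_derivative_at_alt
proof (intro conjI allI impI)
  show "bounded_linear (\<lambda>v. F' x (v # vs))" by (rule bounded_multilinear_head[OF F' vs])
next
  fix e :: real assume "e > 0"
  \<comment> \<open>The summand 1 avoids division by 0 when one of the arguments vanishes.\<close>
  define e' where "e' = e / (1 + prod_list (map norm vs))"
  have pos: "1 + prod_list (map norm vs) > 0" using prod_list_norm_nonneg[of vs] by linarith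
  have e': "e' > 0" using \<open>e > 0\<close> pos by (simp add: e'_def)
  obtain d where d: "d > 0" "\<And>y vs. y \<in> U \<Longrightarrow> dist y x < d \<Longrightarrow> length vs = m \<Longrightarrow>
        norm (F y vs - F x vs - F' x ((y - x) # vs)) \<le> e' * norm (y - x) * prod_list (map norm vs)"
    using multi_derivD[OF F U(2) e'] by metis
  obtain r where r: "r > 0" "ball x r \<subseteq> U" using U openE by blast
  have "norm (F y vs - F x vs - F' x ((y - x) # vs)) \<le> e * norm (y - x)" if "norm (y - x) < min d r" for y
  proof -
    have "y \<in> U" "dist y x < d" using that r by (auto simp: dist_norm norm_minus_commute)
    from d(2)[OF this vs] have "norm (F y vs - F x vs - F' x ((y - x) # vs)) \<le> (e' * prod_list (map norm vs)) * norm (y - x)"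
      by (simp add: mult_ac)
    also have "\<dots> \<le> e * norm (y - x)"
    proof (rule mult_right_mono)
      have "e * prod_list (map norm vs) \<le> e * (1 + prod_list (map norm vs))" using \<open>e > 0\<close> by (simp add: field_simps)
      then show "e' * prod_list (map norm vs) \<le> e" using pos by (simp add: e'_def divide_simps)
    qed simp
    finally show ?thesis .
  qed
  then show "\<exists>d>0. \<forall>y. norm (y - x) < d \<longrightarrow> norm (F y vs - F x vs - F' x ((y - x) # vs)) \<le> e * norm (y - x)"
    using d(1) r(1) by (intro exI[of _ "min d r"]) auto
qed

text \<open>Each order supplies its own derivative of \<open>F\<close>. On an open set they all
  agree with \<open>frechet_derivative\<close>, which therefore works for every order at
  once.\<close>

lemma smooth_multi_deriv:
  assumes U: "open U" and F: "smooth_multi U m F"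
  obtains F' where "multi_deriv U m F F'" "smooth_multi U (Suc m) F'"
proof -
  define F' where "F' = (\<lambda>x ws. frechet_derivative (\<lambda>y. F y (tl ws)) (at x) (hd ws))"
  have "multi_deriv U m F F' \<and> smooth_upto U n (Suc m) F'" for n
  proof -
    obtain H where H: "multi_deriv U m F H" "smooth_upto U n (Suc m) H"
      using F by (metis smooth_multi_def smooth_upto.simps(2))
    have eq: "H x ws = F' x ws" if "x \<in> U" "length ws = Suc m" for x ws
    proof -
      obtain v vs where ws: "ws = v # vs" "length vs = m" using \<open>length ws = Suc m\<close> by (metis length_Suc_conv)
      have "((\<lambda>y. F y vs) has_derivative (\<lambda>v. H x (v # vs))) (at x)"
        using multi_deriv_has_derivative[OF H(1) U that(1) _ ws(2)] smooth_upto_multilinear[OF H(2) that(1)] by blast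
      from frechet_derivative_at[OF this] show ?thesis unfolding F'_def ws by (metis list.sel(1,3))
    qed
    show ?thesis using multi_deriv_cong[OF H(1)] smooth_upto_cong[OF H(2)] eq by blast
  qed
  then show ?thesis using that[of F'] unfolding smooth_multi_def by blast
qed

lemma smooth_on_iff_smooth_multi:
  assumes U: "open U"
  shows "smooth_on U f \<longleftrightarrow> smooth_multi U 0 (\<lambda>x vs. f x)"
proof
  assume "smooth_on U f"
  then obtain D where D: "\<And>x. x \<in> U \<Longrightarrow> D 0 x [] = f x" "\<And>k x. x \<in> U \<Longrightarrow> bounded_multilinear k (D k x)"
    "\<And>k x e. x \<in> U \<Longrightarrow> e > 0 \<Longrightarrow> \<forall>\<^sub>F y in at x within U. \<forall>vs. length vs = k \<longrightarrow>
           norm (D k y vs - D k x vs - D (Suc k) x ((y - x) # vs)) \<le> e * norm (y - x) * prod_list (map norm vs)"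
    unfolding smooth_on_def by blast
  have md: "multi_deriv U k (D k) (D (Suc k))" for k
    unfolding multi_deriv_def
  proof (intro ballI allI impI)
    fix x and e :: real assume x: "x \<in> U" and "e > 0"
    from D(3)[OF this] obtain d where d: "d > 0" "\<And>y vs. y \<in> U \<Longrightarrow> y \<noteq> x \<Longrightarrow> dist y x < d \<Longrightarrow> length vs = k \<Longrightarrow> 
           norm (D k y vs - D k x vs - D (Suc k) x ((y - x) # vs)) \<le> e * norm (y - x) * prod_list (map norm vs)"
      unfolding eventually_at by metis
    \<comment> \<open>The filter \<open>at x within U\<close> omits \<open>y = x\<close>; there the
      remainder vanishes by linearity in the head argument.\<close>
    have "D (Suc k) x (0 # vs) = 0" if "length vs = k" for vs
      using linear_0[OF bounded_linear.linear[OF bounded_multilinear_head[OF D(2)[OF x] that]]] by simp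
    then show "\<exists>d>0. \<forall>y\<in>U. dist y x < d \<longrightarrow> (\<forall>vs. length vs = k \<longrightarrow>
           norm (D k y vs - D k x vs - D (Suc k) x ((y - x) # vs)) \<le> e * norm (y - x) * prod_list (map norm vs))"
      using d(1) d(2) by (intro exI[of _ d]) (metis diff_self mult_zero_left mult_zero_right norm_zero order_refl)
  qed
  have "smooth_upto U n k (D k)" for n k
  proof (induction n arbitrary: k)
    case (Suc n)
    from md[of k] Suc[of "Suc k"] show ?case using D(2) by auto
  qed (use D(2) in auto)
  then have "smooth_upto U n 0 (\<lambda>x vs. f x)" for n
    by (rule smooth_upto_cong) (auto simp: D(1))
  then show "smooth_multi U 0 (\<lambda>x vs. f x)" by (simp add: smooth_multi_def)
next
  assume f: "smooth_multi U 0 (\<lambda>x vs. f x)"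
  \<comment> \<open>Dependent choice of a tower of derivatives; the clause for \<open>k = 0\<close>
    pins its start to \<open>f\<close>.\<close>
  have "\<exists>D. \<forall>k. (smooth_multi U k (D k) \<and> (k = 0 \<longrightarrow> D k = (\<lambda>x vs. f x))) \<and> multi_deriv U k (D k) (D (Suc k))"
  proof (rule dependent_nat_choice)
    fix F :: "'a \<Rightarrow> 'a list \<Rightarrow> 'b" and k
    assume "smooth_multi U k F \<and> (k = 0 \<longrightarrow> F = (\<lambda>x vs. f x))"
    then obtain F' where "multi_deriv U k F F'" "smooth_multi U (Suc k) F'"
      using smooth_multi_deriv[OF U] by blast
    then show "\<exists>F'. (smooth_multi U (Suc k) F' \<and> (Suc k = 0 \<longrightarrow> F' = (\<lambda>x vs. f x))) \<and> multi_deriv U k F F'"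
      by blast
  qed (use f in blast)
  then obtain D where D: "\<And>k. smooth_multi U k (D k)" "D 0 = (\<lambda>x vs. f x)" "\<And>k. multi_deriv U k (D k) (D (Suc k))" by blast
  show "smooth_on U f" unfolding smooth_on_def
  proof (intro exI[of _ D] conjI ballI allI impI)
    show "bounded_multilinear k (D k x)" if "x \<in> U" for k x
      using D(1) that smooth_upto_multilinear unfolding smooth_multi_def by blast
    show "\<forall>\<^sub>F y in at x within U. \<forall>vs. length vs = k \<longrightarrow>
           norm (D k y vs - D k x vs - D (Suc k) x ((y - x) # vs)) \<le> e * norm (y - x) * prod_list (map norm vs)"
      if "x \<in> U" "e > 0" for k x e
      using D(3)[of k] that unfolding multi_deriv_def eventually_at by metis
  qed (simp add: D(2))
qed

section \<open>Sums, linear substitutions, permutations of arguments and composition\<close>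

lemma multi_deriv_add:
  assumes F: "multi_deriv U m F F'" and G: "multi_deriv U m G G'"
  shows "multi_deriv U m (\<lambda>x vs. F x vs + G x vs) (\<lambda>x vs. F' x vs + G' x vs)"
  unfolding multi_deriv_def
proof (intro ballI allI impI)
  fix x and e :: real assume x: "x \<in> U" and "e > 0"
  then have e2: "e / 2 > 0" by simp
  obtain d1 where d1: "d1 > 0" "\<And>y vs. y \<in> U \<Longrightarrow> dist y x < d1 \<Longrightarrow> length vs = m \<Longrightarrow>
        norm (F y vs - F x vs - F' x ((y - x) # vs)) \<le> e / 2 * norm (y - x) * prod_list (map norm vs)"
    using multi_derivD[OF F x e2] by metis
  obtain d2 where d2: "d2 > 0" "\<And>y vs. y \<in> U \<Longrightarrow> dist y x < d2 \<Longrightarrow> length vs = m \<Longrightarrow>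
        norm (G y vs - G x vs - G' x ((y - x) # vs)) \<le> e / 2 * norm (y - x) * prod_list (map norm vs)"
    using multi_derivD[OF G x e2] by metis
  show "\<exists>d>0. \<forall>y\<in>U. dist y x < d \<longrightarrow> (\<forall>vs. length vs = m \<longrightarrow>
      norm (F y vs + G y vs - (F x vs + G x vs) - (F' x ((y - x) # vs) + G' x ((y - x) # vs))) \<le> e * norm (y - x) * prod_list (map norm vs))"
  proof (intro exI[of _ "min d1 d2"] conjI ballI impI allI)
    fix y and vs :: "'a list" assume y: "y \<in> U" "dist y x < min d1 d2" and vs: "length vs = m"
    have "norm (F y vs + G y vs - (F x vs + G x vs) - (F' x ((y - x) # vs) + G' x ((y - x) # vs)))
      \<le> norm (F y vs - F x vs - F' x ((y - x) # vs)) + norm (G y vs - G x vs - G' x ((y - x) # vs))"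
      by (rule order_trans[OF _ norm_triangle_ineq]) (simp add: algebra_simps)
    also have "\<dots> \<le> e * norm (y - x) * prod_list (map norm vs)"
      using d1(2)[OF y(1) _ vs] d2(2)[OF y(1) _ vs] y(2) by (simp add: field_simps)
    finally show "norm (F y vs + G y vs - (F x vs + G x vs) - (F' x ((y - x) # vs) + G' x ((y - x) # vs)))
       \<le> e * norm (y - x) * prod_list (map norm vs)" .
  qed (use d1 d2 in auto)
qed

lemma smooth_upto_add:
  assumes "smooth_upto U n m F" "smooth_upto U n m G"
  shows "smooth_upto U n m (\<lambda>x vs. F x vs + G x vs)"
  using assms
proof (induction n arbitrary: m F G)
  case (Suc n)
  then obtain F' G' where "multi_deriv U m F F'" "smooth_upto U n (Suc m) F'"
    "multi_deriv U m G G'" "smooth_upto U n (Suc m) G'" by auto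
  then show ?case using Suc multi_deriv_add[of U m F F' G G'] by (auto intro: bounded_multilinear_add)
qed (auto intro: bounded_multilinear_add)

text \<open>Linear outer and inner maps create no new factors in the chain rule: the derivative has
  the same form with \<open>F'\<close> for \<open>F\<close>.\<close>

lemma smooth_upto_compose_linear:
  assumes T: "bounded_linear T" and j: "bounded_linear j" and "smooth_upto U n m F"
  shows "smooth_upto (j -` U) n m (\<lambda>x vs. T (F (j x) (map j vs)))"
  using assms(3)
proof (induction n arbitrary: m F)
  case (Suc n)
  then obtain F' where F': "multi_deriv U m F F'" "smooth_upto U n (Suc m) F'" by auto
  obtain CT where CT: "CT > 0" "\<And>v. norm (T v) \<le> norm v * CT"
    using bounded_linear.pos_bounded[OF T] by blast
  obtain Cj where Cj: "Cj > 0" "\<And>v. norm (j v) \<le> norm v * Cj"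
    using bounded_linear.pos_bounded[OF j] by blast
  have "multi_deriv (j -` U) m (\<lambda>x vs. T (F (j x) (map j vs))) (\<lambda>x vs. T (F' (j x) (map j vs)))"
    unfolding multi_deriv_def
  proof (intro ballI allI impI)
    fix x and e :: real assume x: "x \<in> j -` U" and "e > 0"
    \<comment> \<open>The divisor collects the bound for \<open>T\<close>, one factor
      \<open>Cj\<close> from the increment and \<open>m\<close> factors from the arguments.\<close>
    define e' where "e' = e / (CT * Cj * Cj ^ m)"
    have "e' > 0" using \<open>e > 0\<close> CT Cj by (simp add: e'_def)
    then obtain d where d: "d > 0" "\<And>y vs. y \<in> U \<Longrightarrow> dist y (j x) < d \<Longrightarrow> length vs = m \<Longrightarrow>
        norm (F y vs - F (j x) vs - F' (j x) ((y - j x) # vs)) \<le> e' * norm (y - j x) * prod_list (map norm vs)"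
      using multi_derivD[OF F'(1), of "j x" e'] x by (metis vimageE)
    show "\<exists>d>0. \<forall>y\<in>j -` U. dist y x < d \<longrightarrow> (\<forall>vs. length vs = m \<longrightarrow>
        norm (T (F (j y) (map j vs)) - T (F (j x) (map j vs)) - T (F' (j x) (map j ((y - x) # vs))))
         \<le> e * norm (y - x) * prod_list (map norm vs))"
    proof (intro exI[of _ "d / Cj"] conjI ballI impI allI)
      fix y and vs :: "'c list" assume y: "y \<in> j -` U" "dist y x < d / Cj" and vs: "length vs = m"
      have jd: "j (y - x) = j y - j x" using j by (simp add: bounded_linear.linear linear_diff)
      have jle: "norm (j y - j x) \<le> norm (y - x) * Cj" using Cj(2)[of "y - x"] by (simp add: jd)
      also have "\<dots> < d" using y Cj by (simp add: dist_norm field_simps)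
      finally have dist: "dist (j y) (j x) < d" by (simp add: dist_norm)
      have "norm (T (F (j y) (map j vs)) - T (F (j x) (map j vs)) - T (F' (j x) (map j ((y - x) # vs))))
         = norm (T (F (j y) (map j vs) - F (j x) (map j vs) - F' (j x) ((j y - j x) # map j vs)))"
        using T by (simp add: bounded_linear.linear linear_diff jd)
      also have "\<dots> \<le> norm (F (j y) (map j vs) - F (j x) (map j vs) - F' (j x) ((j y - j x) # map j vs)) * CT"
        by (rule CT)
      also have "\<dots> \<le> (e' * norm (j y - j x) * prod_list (map norm (map j vs))) * CT"
        using y vs CT(1) by (intro mult_right_mono d(2) dist) auto
      also have "\<dots> \<le> (e' * (norm (y - x) * Cj) * (Cj ^ m * prod_list (map norm vs))) * CT"
      proof (intro mult_right_mono mult_mono)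
        show "prod_list (map norm (map j vs)) \<le> Cj ^ m * prod_list (map norm vs)"
          using prod_list_norm_map_le[of j Cj vs] Cj vs by auto
      qed (use \<open>e' > 0\<close> Cj CT jle in \<open>auto intro!: mult_nonneg_nonneg simp del: map_map\<close>)
      also have "\<dots> = e * norm (y - x) * prod_list (map norm vs)"
        using CT(1) Cj(1) by (simp add: e'_def)
      finally show "norm (T (F (j y) (map j vs)) - T (F (j x) (map j vs)) - T (F' (j x) (map j ((y - x) # vs))))
         \<le> e * norm (y - x) * prod_list (map norm vs)" .
    qed (use d Cj in auto)
  qed
  moreover have "smooth_upto (j -` U) n (Suc m) (\<lambda>x vs. T (F' (j x) (map j vs)))"
    by (rule Suc.IH[OF F'(2)])
  ultimately show ?case using Suc.prems by (auto intro: bounded_multilinear_compose_linear[OF _ T j])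
qed (auto intro: bounded_multilinear_compose_linear[OF _ T j])

lemma smooth_upto_permute:
  assumes "smooth_upto U n m F" "distinct js" "set js = {..<m}"
  shows "smooth_upto U n m (\<lambda>x vs. F x (map ((!) vs) js))"
  using assms
proof (induction n arbitrary: m F js)
  case (Suc n)
  then obtain F' where F': "multi_deriv U m F F'" "smooth_upto U n (Suc m) F'" by auto
  have len: "length js = m" using Suc.prems by (metis card_lessThan distinct_card)
  \<comment> \<open>The new direction stays at the head, so the old slots move up by one.\<close>
  have "multi_deriv U m (\<lambda>x vs. F x (map ((!) vs) js)) (\<lambda>x vs. F' x (map ((!) vs) (0 # map Suc js)))"
    unfolding multi_deriv_def
  proof (intro ballI allI impI)
    fix x and e :: real assume x: "x \<in> U" and "e > 0"
    then obtain d where d: "d > 0" "\<And>y vs. y \<in> U \<Longrightarrow> dist y x < d \<Longrightarrow> length vs = m \<Longrightarrow>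
        norm (F y vs - F x vs - F' x ((y - x) # vs)) \<le> e * norm (y - x) * prod_list (map norm vs)"
      using multi_derivD[OF F'(1)] by metis
    show "\<exists>d>0. \<forall>y\<in>U. dist y x < d \<longrightarrow> (\<forall>vs. length vs = m \<longrightarrow>
        norm (F y (map ((!) vs) js) - F x (map ((!) vs) js) - F' x (map ((!) ((y - x) # vs)) (0 # map Suc js)))
         \<le> e * norm (y - x) * prod_list (map norm vs))"
    proof (intro exI[of _ d] conjI ballI impI allI)
      fix y and vs :: "'a list" assume y: "y \<in> U" "dist y x < d" and vs: "length vs = m"
      have "prod_list (map norm (map ((!) vs) js)) = prod_list (map norm vs)"
        using prod_list_norm_permute[of js vs] Suc.prems vs by simp
      moreover have "map ((!) ((y - x) # vs)) (0 # map Suc js) = (y - x) # map ((!) vs) js" by simp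
      ultimately show "norm (F y (map ((!) vs) js) - F x (map ((!) vs) js) - F' x (map ((!) ((y - x) # vs)) (0 # map Suc js)))
         \<le> e * norm (y - x) * prod_list (map norm vs)"
        using d(2)[OF y, of "map ((!) vs) js"] len by (simp only: length_map)
    qed (rule d)
  qed
  moreover have "smooth_upto U n (Suc m) (\<lambda>x vs. F' x (map ((!) vs) (0 # map Suc js)))"
  proof (rule Suc.IH[OF F'(2)])
    show "distinct (0 # map Suc js)" using Suc.prems by (simp add: distinct_map)
    show "set (0 # map Suc js) = {..<Suc m}" using Suc.prems by (simp add: lessThan_Suc_eq_insert_0)
  qed
  ultimately show ?case using Suc.prems by (auto intro: bounded_multilinear_permute)
qed (auto intro: bounded_multilinear_permute)

text \<open>A derivative has its direction at the head, whereas a plugged map expects the arguments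
  of \<open>L\<close> there; this permutation moves the direction behind them.\<close>

lemma map_nth_insert_permutation:
  assumes "length ws = Suc (p + m)"
  shows "map ((!) ws) ([1..<Suc p] @ 0 # [Suc p..<Suc (p + m)]) = take p (tl ws) @ hd ws # drop p (tl ws)"
proof -
  obtain u vs where ws: "ws = u # vs" "length vs = p + m" using assms by (metis length_Suc_conv)
  have "map ((!) ws) [1..<Suc p] = take p vs"
    using ws by (intro nth_equalityI) (auto simp del: upt_Suc)
  moreover have "map ((!) ws) [Suc p..<Suc (p + m)] = drop p vs"
    using ws by (intro nth_equalityI) (auto simp del: upt_Suc)
  ultimately show ?thesis using ws by simp
qed

text \<open>Product rule. The error consists of the remainder of \<open>G\<close> at the value of
  \<open>L y\<close>, a mixed second-order term in which \<open>G'\<close> meets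
  \<open>L y - L x\<close>, and \<open>G\<close> applied to the remainder of
  \<open>L\<close>.\<close>

lemma multi_deriv_plug:
  assumes G: "multi_deriv U (Suc m) G G'" and L: "multi_deriv U p L L'"
    and bml: "\<And>x. x \<in> U \<Longrightarrow> bounded_multilinear (Suc m) (G x)" "\<And>x. x \<in> U \<Longrightarrow> bounded_multilinear (Suc (Suc m)) (G' x)"
      "\<And>x. x \<in> U \<Longrightarrow> bounded_multilinear p (L x)" "\<And>x. x \<in> U \<Longrightarrow> bounded_multilinear (Suc p) (L' x)"
  shows "multi_deriv U (p + m) (\<lambda>x vs. G x (L x (take p vs) # drop p vs))
    (\<lambda>x ws. G' x (hd ws # L x (take p (tl ws)) # drop p (tl ws)) + G x (L' x (hd ws # take p (tl ws)) # drop p (tl ws)))"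
  unfolding multi_deriv_def
proof (intro ballI allI impI)
  fix x and e :: real assume x: "x \<in> U" and e: "e > 0"
  obtain C where C: "C > 0" "\<And>vs. length vs = Suc m \<Longrightarrow> norm (G x vs) \<le> C * prod_list (map norm vs)"
    using bounded_multilinear_bound[OF bml(1)[OF x]] by metis
  obtain C' where C': "C' > 0" "\<And>vs. length vs = Suc (Suc m) \<Longrightarrow> norm (G' x vs) \<le> C' * prod_list (map norm vs)"
    using bounded_multilinear_bound[OF bml(2)[OF x]] by metis
  obtain K where K: "K > 0" "\<And>vs. length vs = p \<Longrightarrow> norm (L x vs) \<le> K * prod_list (map norm vs)"
    using bounded_multilinear_bound[OF bml(3)[OF x]] by metis
  obtain K' d1 where K': "K' > 0" "d1 > 0" "\<And>y vs. y \<in> U \<Longrightarrow> dist y x < d1 \<Longrightarrow> length vs = p \<Longrightarrow>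
        norm (L y vs - L x vs) \<le> K' * norm (y - x) * prod_list (map norm vs)"
    using multi_deriv_lipschitz[OF L x bml(4)[OF x]] by metis
  \<comment> \<open>The two remainders cost \<open>e1 * (K + K')\<close> and \<open>e1 * C\<close>,
    together \<open>e / 2\<close>; the other half is for the mixed term.\<close>
  define e1 where "e1 = e / (2 * (K + K' + C))"
  have e1: "e1 > 0" using e K K' C by (simp add: e1_def)
  obtain d2 where d2: "d2 > 0" "\<And>y vs. y \<in> U \<Longrightarrow> dist y x < d2 \<Longrightarrow> length vs = Suc m \<Longrightarrow>
        norm (G y vs - G x vs - G' x ((y - x) # vs)) \<le> e1 * norm (y - x) * prod_list (map norm vs)"
    using multi_derivD[OF G x e1] by metis
  obtain d3 where d3: "d3 > 0" "\<And>y vs. y \<in> U \<Longrightarrow> dist y x < d3 \<Longrightarrow> length vs = p \<Longrightarrow>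
        norm (L y vs - L x vs - L' x ((y - x) # vs)) \<le> e1 * norm (y - x) * prod_list (map norm vs)"
    using multi_derivD[OF L x e1] by metis
  \<comment> \<open>The bound 1 gives the constant \<open>K + K'\<close> for \<open>L y\<close>; the
    second bound makes \<open>C' * K' * norm u\<close>, the factor in the mixed term, at most
    \<open>e / 2\<close>.\<close>
  define d where "d = min (min 1 (e / (2 * (C' * K')))) (min d1 (min d2 d3))"
  have d: "d > 0" using e C' K' d2 d3 by (simp add: d_def)
  show "\<exists>d>0. \<forall>y\<in>U. dist y x < d \<longrightarrow> (\<forall>vs. length vs = p + m \<longrightarrow>
      norm (G y (L y (take p vs) # drop p vs) - G x (L x (take p vs) # drop p vs) -
        (G' x (hd ((y - x) # vs) # L x (take p (tl ((y - x) # vs))) # drop p (tl ((y - x) # vs))) +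
         G x (L' x (hd ((y - x) # vs) # take p (tl ((y - x) # vs))) # drop p (tl ((y - x) # vs)))))
      \<le> e * norm (y - x) * prod_list (map norm vs))"
  proof (intro exI[of _ d] conjI d ballI impI allI)
    fix y and vs :: "'a list" assume y: "y \<in> U" "dist y x < d" and vs: "length vs = p + m"
    define a b u where "a = take p vs" and "b = drop p vs" and "u = y - x"
    have len: "length a = p" "length b = m" using vs by (auto simp: a_def b_def)
    define A B where "A = prod_list (map norm a)" and "B = prod_list (map norm b)"
    have AB: "A * B = prod_list (map norm vs)" "A \<ge> 0" "B \<ge> 0"
      using prod_list_norm_take_drop[of p vs] by (auto simp: A_def B_def a_def b_def)
    have dist: "norm u < 1" "norm u < e / (2 * (C' * K'))" "dist y x < d1" "dist y x < d2" "dist y x < d3"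
      using y(2) by (auto simp: d_def u_def dist_norm)
    have dL: "norm (L y a - L x a) \<le> K' * norm u * A"
      using K'(3)[OF y(1) dist(3) len(1)] by (simp add: u_def A_def)
    have "norm (L y a) \<le> norm (L x a) + norm (L y a - L x a)" by (metis add.commute diff_add_cancel norm_triangle_ineq)
    also have "\<dots> \<le> K * A + K' * norm u * A" using dL K(2)[OF len(1)] by (simp add: A_def)
    also have "\<dots> \<le> K * A + K' * 1 * A"
      using dist(1) K'(1) AB by (intro add_mono mult_right_mono mult_left_mono) auto
    finally have Ly: "norm (L y a) \<le> (K + K') * A" by (simp add: algebra_simps)
    have lin: "G x (L y a # b) - G x (L x a # b) - G x (L' x (u # a) # b) = G x ((L y a - L x a - L' x (u # a)) # b)"
      by (simp add: linear_diff[OF bounded_linear.linear[OF bounded_multilinear_head[OF bml(1)[OF x] len(2)]]])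
    have lin': "G' x (u # L y a # b) - G' x (u # L x a # b) = G' x (u # (L y a - L x a) # b)"
      using linear_diff[OF bounded_multilinear_linear[OF bml(2)[OF x], of "[u]" b]] len by simp
    have "norm (G y (L y a # b) - G x (L y a # b) - G' x (u # L y a # b)) \<le> e1 * norm u * (norm (L y a) * B)"
      using d2(2)[OF y(1) dist(4), of "L y a # b"] len by (simp add: u_def B_def)
    also have "\<dots> \<le> e1 * norm u * ((K + K') * A * B)"
      using e1 Ly AB by (intro mult_left_mono mult_right_mono) auto
    finally have t1: "norm (G y (L y a # b) - G x (L y a # b) - G' x (u # L y a # b)) \<le> (e1 * (K + K')) * (norm u * (A * B))"
      by (simp add: mult_ac)
    have "norm (G' x (u # (L y a - L x a) # b)) \<le> C' * (norm u * (norm (L y a - L x a) * B))"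
      using C'(2)[of "u # (L y a - L x a) # b"] len by (simp add: B_def)
    also have "\<dots> \<le> C' * (norm u * ((K' * norm u * A) * B))"
      using C' dL AB by (intro mult_left_mono mult_right_mono) auto
    also have "\<dots> = (C' * K' * norm u) * (norm u * (A * B))" by (simp add: mult_ac)
    also have "\<dots> \<le> (e / 2) * (norm u * (A * B))"
      using dist(2) C'(1) K'(1) AB by (intro mult_right_mono) (auto simp: field_simps)
    finally have t2: "norm (G' x (u # (L y a - L x a) # b)) \<le> (e / 2) * (norm u * (A * B))" .
    have "norm (G x ((L y a - L x a - L' x (u # a)) # b)) \<le> C * (norm (L y a - L x a - L' x (u # a)) * B)"
      using C(2)[of "(L y a - L x a - L' x (u # a)) # b"] len by (simp add: B_def)
    also have "\<dots> \<le> C * ((e1 * norm u * A) * B)"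
      using C(1) d3(2)[OF y(1) dist(5) len(1)] AB by (intro mult_left_mono mult_right_mono) (auto simp: u_def A_def)
    finally have t3: "norm (G x ((L y a - L x a - L' x (u # a)) # b)) \<le> (e1 * C) * (norm u * (A * B))" by (simp add: mult_ac)
    have "G y (L y a # b) - G x (L x a # b) - (G' x (u # L x a # b) + G x (L' x (u # a) # b))
       = (G y (L y a # b) - G x (L y a # b) - G' x (u # L y a # b)) + G' x (u # (L y a - L x a) # b)
         + G x ((L y a - L x a - L' x (u # a)) # b)"
      unfolding lin[symmetric] lin'[symmetric] by (simp add: algebra_simps)
    also have "norm \<dots> \<le> (e1 * (K + K')) * (norm u * (A * B)) + (e / 2) * (norm u * (A * B)) + (e1 * C) * (norm u * (A * B))"
      by (intro norm_triangle_mono t1 t2 t3)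
    also have "\<dots> = (e1 * (K + K' + C) + e / 2) * (norm u * (A * B))" by (simp add: algebra_simps)
    also have "e1 * (K + K' + C) = e / 2" using K(1) K'(1) C(1) by (simp add: e1_def field_simps)
    finally show "norm (G y (L y (take p vs) # drop p vs) - G x (L x (take p vs) # drop p vs) -
        (G' x (hd ((y - x) # vs) # L x (take p (tl ((y - x) # vs))) # drop p (tl ((y - x) # vs))) +
         G x (L' x (hd ((y - x) # vs) # take p (tl ((y - x) # vs))) # drop p (tl ((y - x) # vs)))))
      \<le> e * norm (y - x) * prod_list (map norm vs)"
      by (simp add: a_def b_def u_def AB)
  qed
qed

text \<open>The derivative is a sum of two maps of the same form up to a permutation of the arguments,
  so the class is closed under this operation at every order.\<close>

lemma smooth_upto_plug:
  assumes "smooth_upto U n (Suc m) G" "smooth_upto U n p L"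
  shows "smooth_upto U n (p + m) (\<lambda>x vs. G x (L x (take p vs) # drop p vs))"
  using assms
proof (induction n arbitrary: m p G L)
  case (Suc n)
  obtain G' where G': "multi_deriv U (Suc m) G G'" "smooth_upto U n (Suc (Suc m)) G'" using Suc.prems by auto
  obtain L' where L': "multi_deriv U p L L'" "smooth_upto U n (Suc p) L'" using Suc.prems by auto
  \<comment> \<open>Plugging acts on the head slot, which in \<open>G'\<close> holds the direction;
    \<open>S\<close> swaps it with the slot meant for \<open>L\<close>.\<close>
  define S where "S = (\<lambda>x vs. G' x (map ((!) vs) (1 # 0 # [2..<Suc (Suc m)])))"
  have "smooth_upto U n (Suc (Suc m)) S" unfolding S_def
    by (intro smooth_upto_permute G') auto
  then have "smooth_upto U n (p + Suc m) (\<lambda>x vs. S x (L x (take p vs) # drop p vs))"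
    using smooth_upto_Suc[OF Suc.prems(2)] by (rule Suc.IH)
  then have "smooth_upto U n (Suc (p + m)) (\<lambda>x vs. S x (L x (take p vs) # drop p vs))" by simp
  from smooth_upto_permute[OF this, of "[1..<Suc p] @ 0 # [Suc p..<Suc (p + m)]"]
  have 1: "smooth_upto U n (Suc (p + m)) (\<lambda>x ws. G' x (hd ws # L x (take p (tl ws)) # drop p (tl ws)))"
  proof (rule smooth_upto_cong)
    show "distinct ([1..<Suc p] @ 0 # [Suc p..<Suc (p + m)])" by auto
    show "set ([1..<Suc p] @ 0 # [Suc p..<Suc (p + m)]) = {..<Suc (p + m)}" by auto
    fix x and ws :: "'a list" assume ws: "length ws = Suc (p + m)"
    have "map ((!) (a # b # c)) (1 # 0 # [2..<Suc (Suc m)]) = b # a # c" if "length c = m" for a b :: 'a and c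
      using that by (auto intro!: nth_equalityI simp del: upt_Suc)
    then show "S x (L x (take p (map ((!) ws) ([1..<Suc p] @ 0 # [Suc p..<Suc (p + m)]))) #
            drop p (map ((!) ws) ([1..<Suc p] @ 0 # [Suc p..<Suc (p + m)])))
        = G' x (hd ws # L x (take p (tl ws)) # drop p (tl ws))"
      unfolding map_nth_insert_permutation[OF ws] S_def using ws by simp
  qed
  \<comment> \<open>Here the direction is the head argument of \<open>L'\<close>, so this summand is
    already a plug, of arity \<open>Suc p\<close>.\<close>
  have "smooth_upto U n (Suc p + m) (\<lambda>x vs. G x (L' x (take (Suc p) vs) # drop (Suc p) vs))"
    using smooth_upto_Suc[OF Suc.prems(1)] L'(2) by (rule Suc.IH)
  then have 2: "smooth_upto U n (Suc (p + m)) (\<lambda>x ws. G x (L' x (hd ws # take p (tl ws)) # drop p (tl ws)))"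
    unfolding add_Suc by (rule smooth_upto_cong) (auto simp: length_Suc_conv)
  have "multi_deriv U (p + m) (\<lambda>x vs. G x (L x (take p vs) # drop p vs))
    (\<lambda>x ws. G' x (hd ws # L x (take p (tl ws)) # drop p (tl ws)) + G x (L' x (hd ws # take p (tl ws)) # drop p (tl ws)))"
    using G' L' Suc.prems by (intro multi_deriv_plug) (blast intro: smooth_upto_multilinear)+
  with smooth_upto_add[OF 1 2] show ?case
    using bounded_multilinear_plug[OF smooth_upto_multilinear[OF Suc.prems(1)] smooth_upto_multilinear[OF Suc.prems(2)]]
    unfolding smooth_upto.simps(2)[of U n] by blast
qed (auto intro: bounded_multilinear_plug)

lemma smooth_upto_const:
  assumes "bounded_multilinear m c"
  shows "smooth_upto U n m (\<lambda>x. c)"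
  using assms
proof (induction n arbitrary: m c)
  case (Suc n)
  have "bounded_multilinear (Suc m) (\<lambda>vs. 0 :: 'b)"
    by (rule bounded_multilinearI[where C=0]) (auto intro: linear_zero)
  from Suc.IH[OF this] have "smooth_upto U n (Suc m) (\<lambda>x vs. 0 :: 'b)" .
  moreover have "multi_deriv U m (\<lambda>x. c) (\<lambda>x vs. 0)"
    unfolding multi_deriv_def by (auto intro!: exI[of _ 1] mult_nonneg_nonneg)
  ultimately show ?case using Suc.prems by auto
qed auto

lemma bounded_multilinear_0: "bounded_multilinear 0 (\<lambda>vs. c)"
  by (rule bounded_multilinearI[where C="norm c"]) auto

lemma bounded_multilinear_1:
  assumes "bounded_linear A"
  shows "bounded_multilinear (Suc 0) (\<lambda>vs. A (hd vs))"
proof -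
  obtain C where "\<And>v. norm (A v) \<le> norm v * C" using bounded_linear.bounded[OF assms] by blast
  then show ?thesis
    by (intro bounded_multilinearI[where C=C]) (auto simp: length_Suc_conv bounded_linear.linear[OF assms] mult.commute)
qed

lemma smooth_upto_linear:
  assumes "bounded_linear A"
  shows "smooth_upto U n 0 (\<lambda>x vs. A x)"
proof (cases n)
  case (Suc k)
  have "multi_deriv U 0 (\<lambda>x vs. A x) (\<lambda>x vs. A (hd vs))"
    using assms unfolding multi_deriv_def by (auto intro!: exI[of _ 1] simp: bounded_linear.linear linear_diff)
  then show ?thesis
    using Suc smooth_upto_const[OF bounded_multilinear_1[OF assms]] by (auto intro: bounded_multilinear_0)
qed (auto intro: bounded_multilinear_0)

section \<open>Perturbations of the identity\<close>

text \<open>\<open>h\<close> can undo at most half of a displacement. This gives injectivity, and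
  the constant 2 for inverses.\<close>

lemma half_lipschitz_expanding:
  fixes h :: "'a::real_normed_vector \<Rightarrow> 'a"
  assumes "norm (h x - h y) \<le> norm (x - y) / 2"
  shows "norm (x - y) \<le> 2 * norm ((x + h x) - (y + h y))"
proof -
  have "x - y = ((x + h x) - (y + h y)) - (h x - h y)" by simp
  then have "norm (x - y) \<le> norm ((x + h x) - (y + h y)) + norm (h x - h y)" by (metis norm_triangle_ineq4)
  with assms show ?thesis by simp
qed

lemma half_lipschitz_inj:
  fixes h :: "'a::real_normed_vector \<Rightarrow> 'a"
  assumes "\<And>x y. x \<in> S \<Longrightarrow> y \<in> S \<Longrightarrow> norm (h x - h y) \<le> norm (x - y) / 2"
  shows "inj_on (\<lambda>x. x + h x) S"
proof (rule inj_onI)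
  fix x y assume "x \<in> S" "y \<in> S" "x + h x = y + h y"
  then show "x = y" using half_lipschitz_expanding[OF assms[of x y]] by simp
qed

text \<open>The solution is the fixed point of \<open>x \<mapsto> z - h x\<close>; the offset of
  \<open>z\<close> and the contraction use up half of the radius each, so the ball is
  invariant.\<close>

lemma half_lipschitz_surj:
  fixes h :: "'a::banach \<Rightarrow> 'a"
  assumes lip: "\<And>x y. x \<in> cball x0 r \<Longrightarrow> y \<in> cball x0 r \<Longrightarrow> norm (h x - h y) \<le> norm (x - y) / 2"
    and r: "r \<ge> 0" and z: "dist z (x0 + h x0) \<le> r / 2"
  obtains x where "x \<in> cball x0 r" "x + h x = z"
proof -
  have "\<exists>!x\<in>cball x0 r. z - h x = x"
  proof (rule Banach_fix[where c="1/2"])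
    show "complete (cball x0 r)" by (simp add: complete_eq_closed)
    show "(\<lambda>x. z - h x) ` cball x0 r \<subseteq> cball x0 r"
    proof clarify
      fix x assume x: "x \<in> cball x0 r"
      have "norm (z - h x - x0) = norm ((z - (x0 + h x0)) + (h x0 - h x))" by (simp add: algebra_simps)
      also have "\<dots> \<le> r / 2 + norm (x0 - x) / 2"
        using z lip[OF _ x, of x0] r by (intro norm_triangle_mono) (auto simp: dist_norm)
      also have "\<dots> \<le> r" using x by (simp add: dist_norm)
      finally show "z - h x \<in> cball x0 r" by (simp add: dist_norm norm_minus_commute)
    qed
    show "dist (z - h x) (z - h y) \<le> 1 / 2 * dist x y" if "x \<in> cball x0 r" "y \<in> cball x0 r" for x y
      using lip[OF that] by (simp add: dist_norm norm_minus_commute)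
  qed (use r in auto)
  then obtain x where "x \<in> cball x0 r" "z - h x = x" by blast
  moreover from this have "x + h x = z" by (metis diff_add_cancel)
  ultimately show ?thesis using that by blast
qed

lemma half_lipschitz_open_image:
  fixes h :: "'a::banach \<Rightarrow> 'a"
  assumes lip: "\<And>x y. x \<in> S \<Longrightarrow> y \<in> S \<Longrightarrow> norm (h x - h y) \<le> norm (x - y) / 2"
    and W: "open W" "W \<subseteq> S"
  shows "open ((\<lambda>x. x + h x) ` W)"
  unfolding open_dist
proof clarify
  fix x0 assume "x0 \<in> W"
  then obtain r where r: "r > 0" "cball x0 r \<subseteq> W" using W(1) open_contains_cball by blast
  have "z \<in> (\<lambda>x. x + h x) ` W" if z: "dist z (x0 + h x0) < r / 2" for z
  proof -
    obtain x where "x \<in> cball x0 r" "x + h x = z"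
      using half_lipschitz_surj[of x0 r h z] lip r W(2) z by (metis less_eq_real_def subsetD)
    then show ?thesis using r by auto
  qed
  then show "\<exists>e>0. \<forall>y. dist y (x0 + h x0) < e \<longrightarrow> y \<in> (\<lambda>x. x + h x) ` W"
    using r(1) by (intro exI[of _ "r/2"]) auto
qed

text \<open>The contraction principle takes the place of a Neumann series; uniqueness of solutions
  makes \<open>L\<close> linear.\<close>

lemma half_contraction_inverse:
  fixes H :: "'a::banach \<Rightarrow> 'a"
  assumes H: "bounded_linear H" and le: "\<And>v. norm (H v) \<le> norm v / 2"
  obtains L where "bounded_linear L" "\<And>v. L v + H (L v) = v" "\<And>v. L (v + H v) = v" "\<And>v. norm (L v) \<le> 2 * norm v"
proof -
  have lip: "norm (H x - H y) \<le> norm (x - y) / 2" for x y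
    using le[of "x - y"] H by (simp add: bounded_linear.linear linear_diff)
  have "\<exists>w. w + H w = v" for v
    using half_lipschitz_surj[of 0 "2 * norm v" H v] lip H by (auto simp: bounded_linear.linear linear_0)
  then obtain L where L: "\<And>v. L v + H (L v) = v" by metis
  have uniq: "w = L v" if "w + H w = v" for w v
    using half_lipschitz_expanding[of H w "L v", OF lip] L[of v] that by simp
  have bound: "norm (L v) \<le> 2 * norm v" for v
    using half_lipschitz_expanding[of H "L v" 0, OF lip] L[of v] H by (simp add: bounded_linear.linear linear_0)
  have "bounded_linear L"
  proof (rule bounded_linear_intro[where K=2])
    show "L (x + y) = L x + L y" for x y
      using L[of x] L[of y] bounded_linear.linear[OF H]
      by (intro uniq[symmetric]) (simp add: linear_add, metis add.assoc add.left_commute)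
    show "L (r *\<^sub>R x) = r *\<^sub>R L x" for r x
      using L[of x] bounded_linear.linear[OF H]
      by (intro uniq[symmetric]) (simp add: linear_scale flip: scaleR_add_right)
  qed (use bound in \<open>simp add: mult.commute\<close>)
  then show ?thesis using that[of L] L uniq bound by metis
qed

text \<open>Differentiating the inverse \<open>L\<close> of \<open>id + Dh\<close> gives \<open>DL (u, v) = - L (D\<^sup>2h (u, L v))\<close>, which
  involves \<open>L\<close> but not its derivative; this makes \<open>L\<close> smooth by bootstrapping.\<close>

lemma multi_deriv_inverse:
  fixes H1 H2 :: "'a::banach \<Rightarrow> 'a list \<Rightarrow> 'a"
  assumes H: "multi_deriv U (Suc 0) H1 H2"
    and bml: "\<And>x. x \<in> U \<Longrightarrow> bounded_multilinear (Suc 0) (H1 x)" "\<And>x. x \<in> U \<Longrightarrow> bounded_multilinear (Suc (Suc 0)) (H2 x)"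
    and L: "\<And>x. x \<in> U \<Longrightarrow> bounded_linear (L x)" "\<And>x v. x \<in> U \<Longrightarrow> L x v + H1 x [L x v] = v"
      "\<And>x v. x \<in> U \<Longrightarrow> L x (v + H1 x [v]) = v" "\<And>x v. x \<in> U \<Longrightarrow> norm (L x v) \<le> 2 * norm v"
  shows "multi_deriv U (Suc 0) (\<lambda>x vs. L x (hd vs)) (\<lambda>x ws. - L x (H2 x [hd ws, L x (ws ! 1)]))"
  unfolding multi_deriv_def
proof (intro ballI allI impI)
  fix x and e :: real assume x: "x \<in> U" and e: "e > 0"
  obtain C d1 where C: "C > 0" "d1 > 0" "\<And>y v. y \<in> U \<Longrightarrow> dist y x < d1 \<Longrightarrow>
        norm (H1 y [v] - H1 x [v]) \<le> C * norm (y - x) * norm v"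
    using multi_deriv_lipschitz[OF H x bml(2)[OF x]] by (metis (no_types, lifting) One_nat_def length_Cons list.size(3) mult.right_neutral list.map prod_list.Cons prod_list.Nil)
  have "e / 8 > 0" using e by simp
  then obtain d2 where d2: "d2 > 0" "\<And>y vs. y \<in> U \<Longrightarrow> dist y x < d2 \<Longrightarrow> length vs = Suc 0 \<Longrightarrow>
        norm (H1 y vs - H1 x vs - H2 x ((y - x) # vs)) \<le> e / 8 * norm (y - x) * prod_list (map norm vs)"
    using multi_derivD[OF H x, of "e / 8"] by metis
  \<comment> \<open>The second application of the resolvent identity below leaves the factor
    \<open>4 * C\<^sup>2 * norm (y - x)\<close>, which becomes at most \<open>e / 4\<close>. With
    the \<open>e / 4\<close> from the remainder of \<open>H1\<close> and
    \<open>norm a \<le> 2 * norm v\<close> the total is \<open>e\<close>.\<close>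
  define d where "d = min (e / (16 * C\<^sup>2)) (min d1 d2)"
  have d: "d > 0" using e C d2 by (simp add: d_def)
  have main: "norm (L y v - L x v + L x (H2 x [y - x, L x v])) \<le> e * norm (y - x) * norm v" 
    if y: "y \<in> U" "dist y x < d" for y v
  proof -
    define a where "a = L x v"
    define w where "w = H1 x [a] - H1 y [a]"
    have dist: "norm (y - x) < e / (16 * C\<^sup>2)" "dist y x < d1" "dist y x < d2"
      using y(2) by (auto simp: d_def dist_norm)
    \<comment> \<open>Resolvent identity; it is used for \<open>v\<close> and once more for
      \<open>w\<close>.\<close>
    have diff: "L y u - L x u = L y (H1 x [L x u] - H1 y [L x u])" for u
    proof -
      have "L y u = L y ((L x u + H1 y [L x u]) + (H1 x [L x u] - H1 y [L x u]))"
        using L(2)[OF x, of u] by simp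
      also have "\<dots> = L x u + L y (H1 x [L x u] - H1 y [L x u])"
        by (subst linear_add[OF bounded_linear.linear[OF L(1)[OF y(1)]]]) (simp only: L(3)[OF y(1)])
      finally show ?thesis by simp
    qed
    have a: "norm a \<le> 2 * norm v" using L(4)[OF x] by (simp add: a_def)
    have w: "norm w \<le> C * norm (y - x) * norm a"
      using C(3)[OF y(1) dist(2), of a] by (simp add: w_def norm_minus_commute)
    have "norm (w + H2 x [y - x, a]) = norm (H1 y [a] - H1 x [a] - H2 x [y - x, a])"
      by (subst norm_minus_cancel[symmetric], simp add: w_def)
    also have "\<dots> \<le> e / 8 * norm (y - x) * norm a" using d2(2)[OF y(1) dist(3), of "[a]"] by simp
    finally have t1: "norm (L x (w + H2 x [y - x, a])) \<le> 2 * (e / 8 * norm (y - x) * norm a)"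
      using L(4)[OF x, of "w + H2 x [y - x, a]"] by linarith
    have "norm (L y w - L x w) = norm (L y (H1 x [L x w] - H1 y [L x w]))" by (simp add: diff)
    also have "\<dots> \<le> 2 * norm (H1 x [L x w] - H1 y [L x w])" by (rule L(4)[OF y(1)])
    also have "\<dots> \<le> 2 * (C * norm (y - x) * norm (L x w))"
      using C(3)[OF y(1) dist(2), of "L x w"] by (simp add: norm_minus_commute)
    also have "\<dots> \<le> 2 * (C * norm (y - x) * (2 * (C * norm (y - x) * norm a)))"
      using C(1) w L(4)[OF x, of w] by (intro mult_left_mono) auto
    also have "\<dots> = (4 * C\<^sup>2 * norm (y - x)) * (norm (y - x) * norm a)" by (simp add: power2_eq_square mult_ac)
    also have "\<dots> \<le> (e / 4) * (norm (y - x) * norm a)"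
      using dist(1) C(1) by (intro mult_right_mono) (auto simp: field_simps)
    finally have t2: "norm (L y w - L x w) \<le> (e / 4) * (norm (y - x) * norm a)" .
    have "L y v - L x v + L x (H2 x [y - x, a]) = (L y w - L x w) + L x (w + H2 x [y - x, a])"
      unfolding diff[of v] linear_add[OF bounded_linear.linear[OF L(1)[OF x]]] by (simp add: a_def w_def)
    also have "norm \<dots> \<le> (e / 4) * (norm (y - x) * norm a) + 2 * (e / 8 * norm (y - x) * norm a)"
      by (intro norm_triangle_mono t1 t2)
    also have "\<dots> = (e / 2 * norm (y - x)) * norm a" by (simp add: field_simps)
    also have "\<dots> \<le> (e / 2 * norm (y - x)) * (2 * norm v)" using e a by (intro mult_left_mono) auto
    finally show ?thesis by (simp add: a_def)
  qed
  show "\<exists>d>0. \<forall>y\<in>U. dist y x < d \<longrightarrow> (\<forall>vs. length vs = Suc 0 \<longrightarrow>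
       norm (L y (hd vs) - L x (hd vs) - - L x (H2 x [hd ((y - x) # vs), L x (((y - x) # vs) ! 1)]))
       \<le> e * norm (y - x) * prod_list (map norm vs))"
    using d main by (intro exI[of _ d]) (auto simp: length_Suc_conv)
qed

lemma smooth_upto_inverse:
  fixes H1 H2 :: "'a::banach \<Rightarrow> 'a list \<Rightarrow> 'a"
  assumes H: "multi_deriv U (Suc 0) H1 H2" "smooth_multi U (Suc 0) H1" "smooth_multi U (Suc (Suc 0)) H2"
    and L: "\<And>x. x \<in> U \<Longrightarrow> bounded_linear (L x)" "\<And>x v. x \<in> U \<Longrightarrow> L x v + H1 x [L x v] = v"
      "\<And>x v. x \<in> U \<Longrightarrow> L x (v + H1 x [v]) = v" "\<And>x v. x \<in> U \<Longrightarrow> norm (L x v) \<le> 2 * norm v"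
  shows "smooth_upto U n (Suc 0) (\<lambda>x vs. L x (hd vs))"
proof (induction n)
  case 0
  show ?case using bounded_multilinear_1[OF L(1)] by simp
next
  case (Suc n)
  \<comment> \<open>\<open>L\<close> has to enter the second slot of \<open>H2\<close>, but plugging
    fills the first: the slots are swapped and swapped back afterwards.\<close>
  have S: "smooth_upto U n (Suc (Suc 0)) (\<lambda>x vs. H2 x (map ((!) vs) [1, 0]))"
    using H(3) by (intro smooth_upto_permute) (auto simp: smooth_multi_def)
  have "smooth_upto U n (Suc 0 + Suc 0) (\<lambda>x vs. H2 x (map ((!) (L x (hd (take (Suc 0) vs)) # drop (Suc 0) vs)) [1, 0]))"
    by (rule smooth_upto_plug[OF S Suc.IH])
  then have "smooth_upto U n (Suc (Suc 0)) (\<lambda>x vs. H2 x (map ((!) (L x (hd (take (Suc 0) vs)) # drop (Suc 0) vs)) [1, 0]))"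
    by simp
  from smooth_upto_permute[OF this, of "[1, 0]"]
  have "smooth_upto U n (Suc (Suc 0)) (\<lambda>x ws. H2 x [hd ws, L x (ws ! 1)])"
    by (rule smooth_upto_cong) (auto simp: length_Suc_conv)
  \<comment> \<open>Now \<open>L\<close> is the outer map: a plug of a bilinear map into a linear
    one.\<close>
  from smooth_upto_plug[OF Suc.IH this, unfolded add_0_right]
  have "smooth_upto U n (Suc (Suc 0)) (\<lambda>x ws. L x (H2 x [hd ws, L x (ws ! 1)]))"
    by (rule smooth_upto_cong) (auto simp: length_Suc_conv)
  from smooth_upto_compose_linear[OF bounded_linear_minus[OF bounded_linear_ident] bounded_linear_ident this]
  have "smooth_upto U n (Suc (Suc 0)) (\<lambda>x ws. - L x (H2 x [hd ws, L x (ws ! 1)]))" by simp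
  moreover have "multi_deriv U (Suc 0) (\<lambda>x vs. L x (hd vs)) (\<lambda>x ws. - L x (H2 x [hd ws, L x (ws ! 1)]))"
    using H by (intro multi_deriv_inverse[OF H(1)] L) (auto intro: smooth_upto_multilinear simp: smooth_multi_def)
  ultimately show ?case using bounded_multilinear_1[OF L(1)] unfolding smooth_upto.simps(2)[of U n] by blast
qed

text \<open>\<open>\<kappa>\<close> solves the equation
  \<open>D\<kappa> = L \<circ> \<kappa>\<close>. So the derivative of
  \<open>G \<circ> \<kappa>\<close> is \<open>G'\<close> with \<open>L\<close> plugged in, composed
  with \<open>\<kappa>\<close>, and the induction closes although nothing beyond first-order
  differentiability of \<open>\<kappa>\<close> is known beforehand.\<close>

lemma smooth_upto_chain:
  fixes \<kappa> :: "'a::real_normed_vector \<Rightarrow> 'a"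
  assumes L: "\<And>n. smooth_upto U n (Suc 0) L" and \<kappa>U: "\<And>z. z \<in> V \<Longrightarrow> \<kappa> z \<in> U"
    and lip: "\<And>z w. z \<in> V \<Longrightarrow> w \<in> V \<Longrightarrow> norm (\<kappa> w - \<kappa> z) \<le> 2 * norm (w - z)"
    and deriv: "\<And>z. z \<in> V \<Longrightarrow> (\<kappa> has_derivative (\<lambda>u. L (\<kappa> z) [u])) (at z within V)"
    and "smooth_upto U n m G"
  shows "smooth_upto V n m (\<lambda>z. G (\<kappa> z))"
  using assms(5)
proof (induction n arbitrary: m G)
  case (Suc n)
  then obtain G' where G': "multi_deriv U m G G'" "smooth_upto U n (Suc m) G'" by auto
  have "multi_deriv V m (\<lambda>z. G (\<kappa> z)) (\<lambda>z ws. G' (\<kappa> z) (L (\<kappa> z) (take (Suc 0) ws) # drop (Suc 0) ws))"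
    unfolding multi_deriv_def
  proof (intro ballI allI impI)
    fix z and e :: real assume z: "z \<in> V" and e: "e > 0"
    have bml: "bounded_multilinear (Suc m) (G' (\<kappa> z))" using smooth_upto_multilinear[OF G'(2) \<kappa>U[OF z]] .
    obtain C where C: "C > 0" "\<And>vs. length vs = Suc m \<Longrightarrow> norm (G' (\<kappa> z) vs) \<le> C * prod_list (map norm vs)"
      using bounded_multilinear_bound[OF bml] by metis
    \<comment> \<open>2 is the Lipschitz constant of \<open>\<kappa>\<close>, and \<open>C\<close>
      multiplies the remainder of \<open>\<kappa>\<close>.\<close>
    define e1 where "e1 = e / (2 + C)"
    have e1: "e1 > 0" using e C by (simp add: e1_def)
    obtain d1 where d1: "d1 > 0" "\<And>y vs. y \<in> U \<Longrightarrow> dist y (\<kappa> z) < d1 \<Longrightarrow> length vs = m \<Longrightarrow>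
        norm (G y vs - G (\<kappa> z) vs - G' (\<kappa> z) ((y - \<kappa> z) # vs)) \<le> e1 * norm (y - \<kappa> z) * prod_list (map norm vs)"
      using multi_derivD[OF G'(1) \<kappa>U[OF z] e1] by metis
    obtain d2 where d2: "d2 > 0" "\<And>w. w \<in> V \<Longrightarrow> norm (w - z) < d2 \<Longrightarrow> norm (\<kappa> w - \<kappa> z - L (\<kappa> z) [w - z]) \<le> e1 * norm (w - z)"
      using deriv[OF z] e1 unfolding has_derivative_within_alt by meson
    show "\<exists>d>0. \<forall>w\<in>V. dist w z < d \<longrightarrow> (\<forall>vs. length vs = m \<longrightarrow>
        norm (G (\<kappa> w) vs - G (\<kappa> z) vs - G' (\<kappa> z) (L (\<kappa> z) (take (Suc 0) ((w - z) # vs)) # drop (Suc 0) ((w - z) # vs)))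
        \<le> e * norm (w - z) * prod_list (map norm vs))"
    proof (intro exI[of _ "min (d1 / 2) d2"] conjI ballI impI allI)
      fix w and vs :: "'a list" assume w: "w \<in> V" "dist w z < min (d1 / 2) d2" and vs: "length vs = m"
      define P where "P = prod_list (map norm vs)"
      have P: "P \<ge> 0" by (simp add: P_def)
      have "dist (\<kappa> w) (\<kappa> z) < d1" using lip[OF z w(1)] w(2) by (simp add: dist_norm)
      from d1(2)[OF \<kappa>U[OF w(1)] this vs]
      have "norm (G (\<kappa> w) vs - G (\<kappa> z) vs - G' (\<kappa> z) ((\<kappa> w - \<kappa> z) # vs)) \<le> e1 * norm (\<kappa> w - \<kappa> z) * P"
        by (simp add: P_def)
      also have "\<dots> \<le> e1 * (2 * norm (w - z)) * P"
        using e1 P lip[OF z w(1)] by (intro mult_left_mono mult_right_mono) auto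
      finally have t1: "norm (G (\<kappa> w) vs - G (\<kappa> z) vs - G' (\<kappa> z) ((\<kappa> w - \<kappa> z) # vs)) \<le> e1 * (2 * norm (w - z)) * P" .
      have "norm (G' (\<kappa> z) ((\<kappa> w - \<kappa> z - L (\<kappa> z) [w - z]) # vs)) \<le> C * (norm (\<kappa> w - \<kappa> z - L (\<kappa> z) [w - z]) * P)"
        using C(2)[of "(\<kappa> w - \<kappa> z - L (\<kappa> z) [w - z]) # vs"] vs by (simp add: P_def)
      also have "\<dots> \<le> C * ((e1 * norm (w - z)) * P)"
        using d2(2)[OF w(1)] w(2) C(1) P by (intro mult_left_mono mult_right_mono) (auto simp: dist_norm)
      finally have t2: "norm (G' (\<kappa> z) ((\<kappa> w - \<kappa> z - L (\<kappa> z) [w - z]) # vs)) \<le> C * ((e1 * norm (w - z)) * P)" .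
      have "G (\<kappa> w) vs - G (\<kappa> z) vs - G' (\<kappa> z) (L (\<kappa> z) [w - z] # vs)
        = (G (\<kappa> w) vs - G (\<kappa> z) vs - G' (\<kappa> z) ((\<kappa> w - \<kappa> z) # vs)) + G' (\<kappa> z) ((\<kappa> w - \<kappa> z - L (\<kappa> z) [w - z]) # vs)"
        by (simp add: linear_diff[OF bounded_linear.linear[OF bounded_multilinear_head[OF bml vs]]])
      also have "norm \<dots> \<le> e1 * (2 * norm (w - z)) * P + C * ((e1 * norm (w - z)) * P)"
        by (intro norm_triangle_mono t1 t2)
      also have "\<dots> = (e1 * (2 + C)) * norm (w - z) * P" by (simp add: algebra_simps)
      also have "e1 * (2 + C) = e" using C(1) by (simp add: e1_def)
      finally show "norm (G (\<kappa> w) vs - G (\<kappa> z) vs - G' (\<kappa> z) (L (\<kappa> z) (take (Suc 0) ((w - z) # vs)) # drop (Suc 0) ((w - z) # vs)))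
        \<le> e * norm (w - z) * prod_list (map norm vs)" by (simp add: P_def)
    qed (use d1 d2 in auto)
  qed
  moreover have "smooth_upto V n (Suc m) (\<lambda>z ws. G' (\<kappa> z) (L (\<kappa> z) (take (Suc 0) ws) # drop (Suc 0) ws))"
    using Suc.IH[OF smooth_upto_plug[OF G'(2) L]] by simp
  ultimately show ?case
    using smooth_upto_multilinear[OF Suc.prems \<kappa>U] unfolding smooth_upto.simps(2)[of V n] by blast
qed (use \<kappa>U in auto)

section \<open>Smooth maps on open sets\<close>

lemma smooth_on_subset:
  assumes "smooth_on U f" "V \<subseteq> U"
  shows "smooth_on V f"
proof -
  have "eventually P (at x within U) \<Longrightarrow> eventually P (at x within V)" for P x
    using assms(2) by (rule filter_leD[OF at_le])
  with assms show ?thesis unfolding smooth_on_def subset_iff by blast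
qed

lemma smooth_on_add:
  assumes "open U" "smooth_on U f" "smooth_on U g"
  shows "smooth_on U (\<lambda>x. f x + g x)"
  using assms(2,3) smooth_upto_add[of U _ 0 "\<lambda>x vs. f x" "\<lambda>x vs. g x"]
  unfolding smooth_on_iff_smooth_multi[OF assms(1)] smooth_multi_def by blast

lemma smooth_on_linear: "open U \<Longrightarrow> bounded_linear A \<Longrightarrow> smooth_on U A"
  by (simp add: smooth_on_iff_smooth_multi smooth_multi_def smooth_upto_linear)

lemma smooth_on_compose_linear:
  assumes "open U" "smooth_on U f" "bounded_linear T" "bounded_linear j"
  shows "smooth_on (j -` U) (\<lambda>x. T (f (j x)))"
proof -
  have "open (j -` U)" using assms by (intro continuous_open_vimage) (auto simp: linear_continuous_at)
  then show ?thesis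
    using assms smooth_upto_compose_linear[OF assms(3,4), of U _ 0 "\<lambda>x vs. f x"]
    by (simp add: smooth_on_iff_smooth_multi smooth_multi_def)
qed

lemma smooth_on_has_derivative:
  assumes "open U" "smooth_on U f" "x \<in> U"
  obtains f' where "(f has_derivative f') (at x)"
proof -
  obtain F' where F': "multi_deriv U 0 (\<lambda>x vs. f x) F'" "smooth_multi U (Suc 0) F'"
    using assms smooth_multi_deriv smooth_on_iff_smooth_multi by metis
  then have "bounded_multilinear (Suc 0) (F' x)" 
    using assms(3) smooth_upto_multilinear unfolding smooth_multi_def by blast
  from multi_deriv_has_derivative[OF F'(1) assms(1,3) this, of "[]"] show ?thesis using that by simp
qed

lemma smooth_on_continuous_on: "open U \<Longrightarrow> smooth_on U f \<Longrightarrow> continuous_on U f"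
  by (blast intro: continuous_at_imp_continuous_on has_derivative_continuous elim: smooth_on_has_derivative)

section \<open>The inverse function theorem near the identity\<close>

lemma derivative_bound_imp_half_lipschitz:
  fixes h :: "'a::real_normed_vector \<Rightarrow> 'a"
  assumes "convex U" "\<And>x. x \<in> U \<Longrightarrow> \<exists>h'. (h has_derivative h') (at x) \<and> (\<forall>v. norm (h' v) \<le> norm v / 2)"
    and "x \<in> U" "y \<in> U"
  shows "norm (h x - h y) \<le> norm (x - y) / 2"
proof -
  obtain h' where h': "\<And>x. x \<in> U \<Longrightarrow> (h has_derivative h' x) (at x)" "\<And>x v. x \<in> U \<Longrightarrow> norm (h' x v) \<le> norm v / 2"
    using assms(2) by metis
  have "norm (h x - h y) \<le> 1/2 * norm (x - y)"
  proof (rule differentiable_bound[OF assms(1) _ _ assms(3,4)])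
    show "(h has_derivative h' x) (at x within U)" if "x \<in> U" for x
      using h'(1)[OF that] has_derivative_at_withinI by blast
    show "onorm (h' x) \<le> 1 / 2" if "x \<in> U" for x
      using h'(2)[OF that] by (intro onorm_bound) auto
  qed
  then show ?thesis by simp
qed

text \<open>The second derivative makes the first one Lipschitz at \<open>p\<close> in the operator
  norm, and it vanishes at \<open>p\<close>; within \<open>1 / (2 * C)\<close> it is therefore at
  most 1/2.\<close>

lemma smooth_on_small_derivative_ball:
  fixes h :: "'a::real_normed_vector \<Rightarrow> 'a"
  assumes U: "open U" "p \<in> U" and h: "smooth_on U h" "(h has_derivative (\<lambda>v. 0)) (at p)"
  obtains r where "r > 0" "ball p r \<subseteq> U" 
    "\<And>x. x \<in> ball p r \<Longrightarrow> \<exists>h'. (h has_derivative h') (at x) \<and> (\<forall>v. norm (h' v) \<le> norm v / 2)"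
proof -
  obtain H1 where H1: "multi_deriv U 0 (\<lambda>x vs. h x) H1" "smooth_multi U (Suc 0) H1"
    using U h smooth_multi_deriv smooth_on_iff_smooth_multi by metis
  obtain H2 where H2: "multi_deriv U (Suc 0) H1 H2" "smooth_multi U (Suc (Suc 0)) H2"
    using smooth_multi_deriv[OF U(1) H1(2)] by metis
  have bml: "bounded_multilinear (Suc 0) (H1 x)" "bounded_multilinear (Suc (Suc 0)) (H2 x)" if "x \<in> U" for x
    using H1(2) H2(2) that smooth_upto_multilinear unfolding smooth_multi_def by blast+
  have der: "(h has_derivative (\<lambda>v. H1 x [v])) (at x)" if "x \<in> U" for x
    using multi_deriv_has_derivative[OF H1(1) U(1) that bml(1)[OF that], of "[]"] by simp
  have H1p: "H1 p [v] = 0" for v using has_derivative_unique[OF der[OF U(2)] h(2)] by meson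
  obtain C d where C: "C > 0" "d > 0" "\<And>y vs. y \<in> U \<Longrightarrow> dist y p < d \<Longrightarrow> length vs = Suc 0 \<Longrightarrow>
        norm (H1 y vs - H1 p vs) \<le> C * norm (y - p) * prod_list (map norm vs)"
    using multi_deriv_lipschitz[OF H2(1) U(2) bml(2)[OF U(2)]] by metis
  obtain r where r: "r > 0" "ball p r \<subseteq> U" using U openE by blast
  show ?thesis
  proof (rule that[of "min r (min d (1 / (2 * C)))"])
    fix x assume x: "x \<in> ball p (min r (min d (1 / (2 * C))))"
    then have xU: "x \<in> U" and xd: "dist x p < d" and xC: "norm (x - p) < 1 / (2 * C)"
      using r by (auto simp: dist_commute) (simp add: dist_norm norm_minus_commute)
    have "norm (H1 x [v]) \<le> norm v / 2" for v
    proof -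
      have "norm (H1 x [v]) \<le> C * norm (x - p) * norm v" using C(3)[OF xU xd, of "[v]"] H1p by simp
      also have "\<dots> \<le> (1 / 2) * norm v" using xC C(1) by (intro mult_right_mono) (auto simp: field_simps)
      finally show ?thesis by simp
    qed
    then show "\<exists>h'. (h has_derivative h') (at x) \<and> (\<forall>v. norm (h' v) \<le> norm v / 2)" using der[OF xU] by blast
  qed (use r C in auto)
qed

text \<open>The inverse \<open>\<kappa>\<close> has derivative \<open>L (\<kappa> z)\<close>, where
  \<open>L\<close> inverts \<open>id + Dh\<close> and is smooth on \<open>U\<close>. Then
  \<open>smooth_upto_chain\<close>, applied to the identity, makes \<open>\<kappa>\<close>
  smooth.\<close>

lemma smooth_diffeomorphism_near_identity:
  fixes h :: "'a::banach \<Rightarrow> 'a"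
  assumes U: "open U" "convex U" and h: "smooth_on U h"
    and bound: "\<And>x. x \<in> U \<Longrightarrow> \<exists>h'. (h has_derivative h') (at x) \<and> (\<forall>v. norm (h' v) \<le> norm v / 2)"
  defines "\<psi> \<equiv> \<lambda>x. x + h x"
  shows "open (\<psi> ` U)" "smooth_diffeomorphism U (\<psi> ` U) \<psi>"
proof -
  have lip: "norm (h x - h y) \<le> norm (x - y) / 2" if "x \<in> U" "y \<in> U" for x y
    using derivative_bound_imp_half_lipschitz[OF U(2) bound that] .
  have inj: "inj_on \<psi> U" unfolding \<psi>_def by (rule half_lipschitz_inj[OF lip])
  show op: "open (\<psi> ` U)" unfolding \<psi>_def by (rule half_lipschitz_open_image[OF lip U(1) subset_refl])
  define \<kappa> where "\<kappa> = inv_into U \<psi>"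
  have \<kappa>: "\<kappa> z \<in> U" "\<psi> (\<kappa> z) = z" if "z \<in> \<psi> ` U" for z
    using that by (auto simp: \<kappa>_def inv_into_into f_inv_into_f)
  obtain H1 where H1: "multi_deriv U 0 (\<lambda>x vs. h x) H1" "smooth_multi U (Suc 0) H1"
    using U h smooth_multi_deriv smooth_on_iff_smooth_multi by metis
  obtain H2 where H2: "multi_deriv U (Suc 0) H1 H2" "smooth_multi U (Suc (Suc 0)) H2"
    using smooth_multi_deriv[OF U(1) H1(2)] by metis
  have bml: "bounded_multilinear (Suc 0) (H1 x)" if "x \<in> U" for x
    using H1(2) that smooth_upto_multilinear unfolding smooth_multi_def by blast
  have bl: "bounded_linear (\<lambda>v. H1 x [v])" if "x \<in> U" for x
    using bounded_multilinear_head[OF bml[OF that], of "[]"] by simp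
  have der: "(h has_derivative (\<lambda>v. H1 x [v])) (at x)" if "x \<in> U" for x
    using multi_deriv_has_derivative[OF H1(1) U(1) that bml[OF that], of "[]"] by simp
  have H1_le: "norm (H1 x [v]) \<le> norm v / 2" if "x \<in> U" for x v
  proof -
    obtain h' where "(h has_derivative h') (at x)" "norm (h' v) \<le> norm v / 2" using bound[OF \<open>x \<in> U\<close>] by blast
    then show ?thesis using has_derivative_unique[OF der[OF \<open>x \<in> U\<close>]] by metis
  qed
  have "\<exists>L. bounded_linear L \<and> (\<forall>v. L v + H1 x [L v] = v) \<and> (\<forall>v. L (v + H1 x [v]) = v) \<and> (\<forall>v. norm (L v) \<le> 2 * norm v)"
    if "x \<in> U" for x
    using half_contraction_inverse[OF bl[OF that] H1_le[OF that]] by metis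
  then obtain L where L: "\<And>x. x \<in> U \<Longrightarrow> bounded_linear (L x)" "\<And>x v. x \<in> U \<Longrightarrow> L x v + H1 x [L x v] = v"
      "\<And>x v. x \<in> U \<Longrightarrow> L x (v + H1 x [v]) = v" "\<And>x v. x \<in> U \<Longrightarrow> norm (L x v) \<le> 2 * norm v"
    by metis
  have Lsm: "smooth_upto U n (Suc 0) (\<lambda>x vs. L x (hd vs))" for n
    by (rule smooth_upto_inverse[OF H2(1) H1(2) H2(2) L])
  have \<kappa>lip: "norm (\<kappa> w - \<kappa> z) \<le> 2 * norm (w - z)" if "z \<in> \<psi> ` U" "w \<in> \<psi> ` U" for z w
    using half_lipschitz_expanding[OF lip[OF \<kappa>(1)[OF that(2)] \<kappa>(1)[OF that(1)]]] \<kappa>(2)[OF that(1)] \<kappa>(2)[OF that(2)]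
    by (simp add: \<psi>_def)
  have \<kappa>der: "(\<kappa> has_derivative (\<lambda>u. L (\<kappa> z) (hd [u]))) (at z within \<psi> ` U)" if z: "z \<in> \<psi> ` U" for z
    unfolding has_derivative_within_alt
  proof (intro conjI allI impI)
    show "bounded_linear (\<lambda>u. L (\<kappa> z) (hd [u]))" using L(1)[OF \<kappa>(1)[OF z]] by simp
    fix e :: real assume "e > 0"
    \<comment> \<open>One factor 2 is lost to the bound for \<open>L\<close>, another to the
      Lipschitz constant of \<open>\<kappa>\<close>.\<close>
    then have e4: "e / 4 > 0" by simp
    obtain d where d: "d > 0" "\<And>y. norm (y - \<kappa> z) < d \<Longrightarrow> norm (h y - h (\<kappa> z) - H1 (\<kappa> z) [y - \<kappa> z]) \<le> e / 4 * norm (y - \<kappa> z)"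
      using der[OF \<kappa>(1)[OF z]] e4 unfolding has_derivative_at_alt by meson
    have "norm (\<kappa> w - \<kappa> z - L (\<kappa> z) (w - z)) \<le> e * norm (w - z)" if w: "w \<in> \<psi> ` U" "norm (w - z) < d / 2" for w
    proof -
      define y where "y = \<kappa> w - \<kappa> z"
      have y: "norm y \<le> 2 * norm (w - z)" using \<kappa>lip[OF z w(1)] by (simp add: y_def)
      have wz: "w - z = (y + H1 (\<kappa> z) [y]) + (h (\<kappa> w) - h (\<kappa> z) - H1 (\<kappa> z) [y])"
        using \<kappa>(2)[OF z] \<kappa>(2)[OF w(1)] by (simp add: \<psi>_def y_def algebra_simps)
      have "L (\<kappa> z) (w - z) = y + L (\<kappa> z) (h (\<kappa> w) - h (\<kappa> z) - H1 (\<kappa> z) [y])"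
        unfolding wz linear_add[OF bounded_linear.linear[OF L(1)[OF \<kappa>(1)[OF z]]]] 
        by (subst L(3)[OF \<kappa>(1)[OF z], symmetric]) (simp add: linear_add[OF bounded_linear.linear[OF L(1)[OF \<kappa>(1)[OF z]]]])
      then have "norm (\<kappa> w - \<kappa> z - L (\<kappa> z) (w - z)) = norm (L (\<kappa> z) (h (\<kappa> w) - h (\<kappa> z) - H1 (\<kappa> z) [y]))"
        by (simp add: y_def)
      also have "\<dots> \<le> 2 * norm (h (\<kappa> w) - h (\<kappa> z) - H1 (\<kappa> z) [y])" by (rule L(4)[OF \<kappa>(1)[OF z]])
      also have "\<dots> \<le> 2 * (e / 4 * norm y)"
        using d(2)[of "\<kappa> w"] y w(2) by (simp add: y_def)
      also have "\<dots> \<le> 2 * (e / 4 * (2 * norm (w - z)))" using y \<open>e > 0\<close> by (intro mult_left_mono) auto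
      finally show ?thesis by simp
    qed
    then show "\<exists>d>0. \<forall>w\<in>\<psi> ` U. norm (w - z) < d \<longrightarrow> norm (\<kappa> w - \<kappa> z - L (\<kappa> z) (hd [w - z])) \<le> e * norm (w - z)"
      using d(1) by (intro exI[of _ "d / 2"]) auto
  qed
  have "smooth_upto (\<psi> ` U) n 0 (\<lambda>z vs. \<kappa> z)" for n
    by (rule smooth_upto_chain[OF Lsm \<kappa>(1) \<kappa>lip \<kappa>der smooth_upto_linear[OF bounded_linear_ident]])
  then have "smooth_on (\<psi> ` U) \<kappa>"
    unfolding smooth_on_iff_smooth_multi[OF op] smooth_multi_def by blast
  moreover have "smooth_on U \<psi>"
    unfolding \<psi>_def by (intro smooth_on_add smooth_on_linear U h bounded_linear_ident)
  ultimately show "smooth_diffeomorphism U (\<psi> ` U) \<psi>"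
    using inj by (simp add: smooth_diffeomorphism_def bij_betw_def \<kappa>_def)
qed

section \<open>Transversal directions in the dense range\<close>

text \<open>For \<open>c \<noteq> 0\<close> rescaling \<open>u - c *\<^sub>R b\<close> by
  \<open>- inverse c\<close> gives a point of \<open>E\<close> at distance
  \<open>norm u / \<bar>c\<bar>\<close> from \<open>b\<close>. So the coordinate along
  \<open>b\<close> is bounded when \<open>E\<close> is closed and
  \<open>b \<notin> E\<close>.\<close>

lemma coefficient_bound:
  fixes E :: "'a::real_normed_vector set"
  assumes "subspace E" "u - c *\<^sub>R b \<in> E" 
  shows "\<bar>c\<bar> * infdist b E \<le> norm u"
proof (cases "c = 0")
  case False
  have "- inverse c *\<^sub>R (u - c *\<^sub>R b) \<in> E"
    using assms by (intro subspace_scale) auto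
  then have "infdist b E \<le> dist b (- inverse c *\<^sub>R (u - c *\<^sub>R b))"
    by (rule infdist_le)
  also have "\<dots> = norm u / \<bar>c\<bar>"
    using False by (simp add: dist_norm scaleR_diff_right divide_inverse mult.commute)
  finally show ?thesis
    using False by (simp add: field_simps)
qed auto

text \<open>The coefficients along \<open>b\<close> of a convergent sequence are Cauchy. This keeps
  the subspaces closed in the induction on the codimension.\<close>

lemma closed_span_insert:
  fixes E :: "'a::real_normed_vector set"
  assumes E: "subspace E" "closed E"
  shows "closed (span (insert b E))"
proof (cases "b \<in> E")
  case True
  then show ?thesis using E by (simp add: insert_absorb span_eq_iff[THEN iffD2])
next
  case False
  define \<delta> where "\<delta> = infdist b E"
  have \<delta>: "\<delta> > 0"
    using False E subspace_0 in_closed_iff_infdist_zero[of E b] infdist_nonneg[of b E] unfolding \<delta>_def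
    by (metis empty_iff less_eq_real_def)
  have sp: "x \<in> span (insert b E) \<longleftrightarrow> (\<exists>c. x - c *\<^sub>R b \<in> E)" for x
    using E by (simp add: span_breakdown_eq span_eq_iff[THEN iffD2])
  show ?thesis unfolding closed_sequential_limits
  proof (intro allI impI, elim conjE)
    fix u l assume u: "\<forall>n. u n \<in> span (insert b E)" and l: "u \<longlonglongrightarrow> l"
    then have "\<forall>n. \<exists>c. u n - c *\<^sub>R b \<in> E" by (simp add: sp)
    then obtain c where c: "\<And>n. u n - c n *\<^sub>R b \<in> E" by metis
    have "Cauchy c"
    proof (rule metric_CauchyI)
      fix e :: real assume "e > 0"
      with \<delta> LIMSEQ_imp_Cauchy[OF l] obtain N where N: "\<And>m n. m \<ge> N \<Longrightarrow> n \<ge> N \<Longrightarrow> dist (u m) (u n) < e * \<delta>"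
        unfolding Cauchy_def by (metis mult_pos_pos)
      have "dist (c m) (c n) < e" if "m \<ge> N" "n \<ge> N" for m n
      proof -
        have "(u m - u n) - (c m - c n) *\<^sub>R b \<in> E"
          using subspace_diff[OF E(1) c c, of m n] by (simp add: algebra_simps)
        from coefficient_bound[OF E(1) this] N[OF that] 
        have "\<bar>c m - c n\<bar> * \<delta> < e * \<delta>" by (simp add: \<delta>_def dist_norm)
        then show ?thesis using \<delta> by (simp add: dist_real_def)
      qed
      then show "\<exists>M. \<forall>m\<ge>M. \<forall>n\<ge>M. dist (c m) (c n) < e" by blast
    qed
    then obtain c0 where "c \<longlonglongrightarrow> c0" by (auto simp: Cauchy_convergent_iff convergent_def)
    then have "(\<lambda>n. u n - c n *\<^sub>R b) \<longlonglongrightarrow> l - c0 *\<^sub>R b" by (intro tendsto_intros l)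
    then have "l - c0 *\<^sub>R b \<in> E" using c E(2) by (meson closed_sequentially)
    then show "l \<in> span (insert b E)" using sp by blast
  qed
qed

text \<open>Induction on the codimension: \<open>T\<close> for \<open>E\<close> is obtained from \<open>T1\<close> for \<open>E \<oplus> \<real> b\<close> by adding a functional
  \<open>\<beta>\<close>, the \<open>b\<close>-coordinate of \<open>x - K (T1 x)\<close>, times a vector \<open>y'\<close> with \<open>K y' \<in> b + E\<close>.  Density of the
  range of \<open>K\<close> makes \<open>\<beta> \<circ> K\<close> nonzero.\<close>

lemma transversal_right_inverse:
  fixes K :: "'y::real_normed_vector \<Rightarrow> 'x::real_normed_vector"
  assumes K: "bounded_linear K" and dense: "closure (range K) = UNIV"
    and E: "finite_codim_subspace E"
  obtains T :: "'x \<Rightarrow> 'y" where "bounded_linear T" "\<And>x. T x = 0 \<longleftrightarrow> x \<in> E" "\<And>x. T (K (T x)) = T x"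
proof -
  \<comment> \<open>\<open>K \<circ> T\<close> is the identity modulo \<open>E\<close>. Together
    with \<open>T = 0\<close> on \<open>E\<close> this forces the kernel to be \<open>E\<close> and
    yields \<open>T \<circ> K \<circ> T = T\<close>.\<close>
  have "\<exists>T :: 'x \<Rightarrow> 'y. bounded_linear T \<and> (\<forall>x\<in>E. T x = 0) \<and> (\<forall>x. K (T x) - x \<in> E)"
    if "finite B" "subspace E" "closed E" "span (E \<union> B) = UNIV" for B E
    using that
  proof (induction B arbitrary: E rule: finite_induct)
    case empty
    then have "E = UNIV" by (simp add: span_eq_iff[THEN iffD2])
    then show ?case by (intro exI[of _ "\<lambda>x. 0"]) auto
  next
    case (insert b B)
    note EE = insert.prems(1,2)
    have cl: "closed (span (insert b E))" by (rule closed_span_insert[OF EE])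
    have "span (span (insert b E) \<union> B) = UNIV"
    proof -
      have "E \<union> insert b B \<subseteq> span (insert b E) \<union> B" by (auto intro: span_base)
      then show ?thesis using insert.prems(3) span_mono by blast
    qed
    from insert.IH[OF subspace_span cl this] obtain T1 :: "'x \<Rightarrow> 'y" where
      T1: "bounded_linear T1" and T10: "\<And>x. x \<in> span (insert b E) \<Longrightarrow> T1 x = 0" 
      and KT1: "\<And>x. K (T1 x) - x \<in> span (insert b E)" by blast
    show ?case
    proof (cases "b \<in> E")
      case True
      then have "span (insert b E) = E" using EE by (simp add: insert_absorb span_eq_iff[THEN iffD2])
      then show ?thesis using T1 T10 KT1 by auto
    next
      case False
      define \<delta> where "\<delta> = infdist b E"
      have \<delta>: "\<delta> > 0"
        using False EE subspace_0 in_closed_iff_infdist_zero[of E b] infdist_nonneg[of b E] unfolding \<delta>_def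
        by (metis empty_iff less_eq_real_def)
      have bl: "bounded_linear (\<lambda>x. x - K (T1 x))"
        by (intro bounded_linear_sub bounded_linear_ident bounded_linear_compose[OF K] T1)
      have "\<exists>c. (x - K (T1 x)) - c *\<^sub>R b \<in> E" for x
      proof -
        have "x - K (T1 x) \<in> span (insert b E)" using span_neg[OF KT1[of x]] by simp
        then show ?thesis using EE by (simp add: span_breakdown_eq span_eq_iff[THEN iffD2])
      qed
      then obtain \<beta> where \<beta>: "\<And>x. (x - K (T1 x)) - \<beta> x *\<^sub>R b \<in> E" by metis
      \<comment> \<open>Uniqueness holds because \<open>b \<notin> E\<close>; linearity of
        \<open>\<beta>\<close> is read off from it.\<close>
      have uniq: "c = \<beta> x" if "(x - K (T1 x)) - c *\<^sub>R b \<in> E" for c x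
      proof -
        have "0 - (c - \<beta> x) *\<^sub>R b \<in> E" using subspace_diff[OF EE(1) that \<beta>[of x]] by (simp add: algebra_simps)
        from coefficient_bound[OF EE(1) this] \<delta> show ?thesis 
          by (simp add: \<delta>_def mult_le_0_iff)
      qed
      obtain C where C: "\<And>x. norm (x - K (T1 x)) \<le> norm x * C" using bounded_linear.bounded[OF bl] by blast
      have bl\<beta>: "bounded_linear \<beta>"
      proof (rule bounded_linear_intro[where K="C / \<delta>"])
        fix x y
        have eq: "(x + y - K (T1 (x + y))) = (x - K (T1 x)) + (y - K (T1 y))"
          using bounded_linear.linear[OF bl] linear_add by blast
        show "\<beta> (x + y) = \<beta> x + \<beta> y"
          by (rule uniq[symmetric], unfold eq) (use subspace_add[OF EE(1) \<beta>[of x] \<beta>[of y]] in \<open>simp add: algebra_simps\<close>)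
      next
        fix r x
        have eq: "(r *\<^sub>R x - K (T1 (r *\<^sub>R x))) = r *\<^sub>R (x - K (T1 x))"
          using bounded_linear.linear[OF bl] linear_scale by blast
        show "\<beta> (r *\<^sub>R x) = r *\<^sub>R \<beta> x"
          by (rule uniq[symmetric], unfold eq) (use subspace_scale[OF EE(1) \<beta>[of x], of r] in \<open>simp add: algebra_simps\<close>)
      next
        fix x
        show "norm (\<beta> x) \<le> norm x * (C / \<delta>)"
          using coefficient_bound[OF EE(1) \<beta>[of x]] C[of x] \<delta> by (simp add: \<delta>_def field_simps)
      qed
      have T1b: "T1 b = 0" by (rule T10) (simp add: span_base)
      have K0: "K 0 = 0" using K by (simp add: bounded_linear.linear linear_0)
      have "\<exists>y. \<beta> (K y) \<noteq> 0"
      proof (rule ccontr)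
        assume "\<not> ?thesis"
        then have "range K \<subseteq> \<beta> -` {0}" by auto
        moreover have "closed (\<beta> -` {0})"
          by (intro continuous_closed_vimage) (auto intro!: linear_continuous_at bl\<beta>)
        ultimately have "\<beta> b = 0" using closure_minimal dense by blast
        with \<beta>[of b] T1b K0 False show False by simp
      qed
      then obtain y where y: "\<beta> (K y) \<noteq> 0" by blast
      \<comment> \<open>Subtracting \<open>T1 (K y)\<close> leaves, after \<open>K\<close>, a vector
        of \<open>E \<oplus> \<real> b\<close> with coefficient \<open>\<beta> (K y)\<close>; the
        scaling makes this coefficient 1.\<close>
      define y' where "y' = inverse (\<beta> (K y)) *\<^sub>R (y - T1 (K y))"
      define T where "T = (\<lambda>x. T1 x + \<beta> x *\<^sub>R y')"
      have Ky': "K y' - b \<in> E"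
      proof -
        have "K y' - b = inverse (\<beta> (K y)) *\<^sub>R (K y - K (T1 (K y)) - \<beta> (K y) *\<^sub>R b)"
          using y bounded_linear.linear[OF K] by (simp add: y'_def linear_scale linear_diff algebra_simps)
        then show ?thesis using subspace_scale[OF EE(1) \<beta>] by metis
      qed
      show ?thesis
      proof (intro exI conjI ballI allI)
        show "bounded_linear T" unfolding T_def
          by (intro bounded_linear_add T1 bounded_linear_compose[OF bounded_linear_scaleR_left] bl\<beta>)
        show "T x = 0" if "x \<in> E" for x
        proof -
          have "T1 x = 0" using that by (intro T10 span_base) auto
          moreover have "\<beta> x = 0" using uniq[of x 0] that \<open>T1 x = 0\<close> K0 by simp
          ultimately show ?thesis by (simp add: T_def)
        qed
        show "K (T x) - x \<in> E" for x
        proof -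
          have "K (T x) - x = \<beta> x *\<^sub>R (K y' - b) - ((x - K (T1 x)) - \<beta> x *\<^sub>R b)"
            using bounded_linear.linear[OF K] by (simp add: T_def linear_scale linear_add algebra_simps)
          then show ?thesis using subspace_diff[OF EE(1) subspace_scale[OF EE(1) Ky'] \<beta>] by metis
        qed
      qed
    qed
  qed
  with E obtain T :: "'x \<Rightarrow> 'y" where T: "bounded_linear T" 
    and T0: "\<And>x. x \<in> E \<Longrightarrow> T x = 0" and KT: "\<And>x. K (T x) - x \<in> E"
    unfolding finite_codim_subspace_def by metis
  have sE: "subspace E" using E by (simp add: finite_codim_subspace_def)
  show ?thesis
  proof (rule that[OF T])
    show "T x = 0 \<longleftrightarrow> x \<in> E" for x
    proof
      assume "T x = 0"
      then have "- x \<in> E" using KT[of x] K by (simp add: bounded_linear.linear linear_0)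
      then show "x \<in> E" using subspace_neg[OF sE] by fastforce
    qed (rule T0)
    show "T (K (T x)) = T x" for x
      using T0[OF KT, of x] T by (simp add: bounded_linear.linear linear_diff)
  qed
qed

section \<open>Approximation and gluing\<close>

lemma separable_euclidean_sequence:
  assumes "separable_space (euclidean :: 'a::metric_space topology)"
  obtains s :: "nat \<Rightarrow> 'a::metric_space" where "\<And>x e. e > 0 \<Longrightarrow> \<exists>n. dist (s n) x < e"
proof -
  obtain C :: "'a set" where C: "countable C" "closure C = UNIV"
    using assms unfolding separable_space_def by auto
  then have "C \<noteq> {}" by auto
  have "\<exists>n. dist (from_nat_into C n) x < e" if "e > 0" for x e
  proof -
    have "x \<in> closure C" using C(2) by simp
    then obtain c where "c \<in> C" "dist c x < e" using \<open>e > 0\<close> unfolding closure_approachable by blast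
    then show ?thesis using from_nat_into_surj[OF C(1)] by metis
  qed
  then show ?thesis using that by blast
qed

lemma continuous_on_suminf_geometric:
  fixes f :: "nat \<Rightarrow> 'a::topological_space \<Rightarrow> 'b::banach"
  assumes "\<And>n. continuous_on S (f n)" "\<And>n x. x \<in> S \<Longrightarrow> norm (f n x) \<le> (1/2) ^ n"
  shows "continuous_on S (\<lambda>x. \<Sum>n. f n x)"
proof (rule uniform_limit_theorem)
  show "uniform_limit S (\<lambda>n x. \<Sum>i<n. f i x) (\<lambda>x. \<Sum>n. f n x) sequentially"
    by (rule Weierstrass_m_test[where M="\<lambda>n. (1/2) ^ n"]) (use assms in auto)
qed (auto intro!: always_eventually continuous_on_sum assms)

text \<open>The weights \<open>w n\<close> are damped by \<open>2\<^sup>-\<^sup>n / (1 + \<parallel>s n\<parallel>)\<close>, so that the weighted means of the points \<open>s n\<close>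
  converge uniformly and no local finiteness is needed.\<close>

lemma dense_range_approximation:
  fixes i :: "'y::banach \<Rightarrow> 'x::banach"
  assumes sep: "separable_space (euclidean :: 'y topology)"
    and i: "bounded_linear i" and dense: "closure (range i) = UNIV"
    and eps: "continuous_on S \<epsilon>" "\<And>x. x \<in> S \<Longrightarrow> \<epsilon> x > 0"
  obtains g where "continuous_on S g" "\<And>x. x \<in> S \<Longrightarrow> norm (i (g x) - x) < \<epsilon> x"
proof -
  obtain s :: "nat \<Rightarrow> 'y" where s: "\<And>x e. e > 0 \<Longrightarrow> \<exists>n. dist (s n) x < e"
    using separable_euclidean_sequence[OF sep] by metis
  have s_dense: "\<exists>n. norm (i (s n) - x) < e" if "e > 0" for x e
  proof -
    have "x \<in> closure (range i)" using dense by simp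
    then obtain y where y: "dist (i y) x < e" using \<open>e > 0\<close> unfolding closure_approachable by blast
    have "isCont i y" using i by (simp add: linear_continuous_at)
    then obtain d where "d > 0" "\<And>z. dist z y < d \<Longrightarrow> dist (i z) (i y) < e - dist (i y) x"
      using y unfolding continuous_at_eps_delta by (metis diff_gt_0_iff_gt)
    then obtain n where "dist (i (s n)) (i y) < e - dist (i y) x" using s by meson
    then have "dist (i (s n)) x < e" using dist_triangle[of "i (s n)" x "i y"] by linarith
    then show ?thesis by (auto simp: dist_norm)
  qed
  \<comment> \<open>The weight is positive only if \<open>i (s n)\<close> is closer to
    \<open>x\<close> than \<open>\<epsilon> x\<close>.\<close>
  define w where "w n x = (1/2) ^ n / (1 + norm (s n)) * min 1 (max 0 (\<epsilon> x - norm (i (s n) - x)))" for n x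
  have w0: "w n x \<ge> 0" for n x by (simp add: w_def)
  have pos: "1 + norm y > 0" for y :: 'y using norm_ge_zero[of y] by linarith
  have wle: "w n x * (1 + norm (s n)) \<le> (1/2) ^ n" for n x
  proof -
    have cancel: "a / b * c * b = a * c" if "b > 0" for a b c :: real using that by simp
    have "w n x * (1 + norm (s n)) = (1/2) ^ n * min 1 (max 0 (\<epsilon> x - norm (i (s n) - x)))"
      unfolding w_def by (rule cancel[OF pos])
    also have "\<dots> \<le> (1/2) ^ n * 1" by (intro mult_left_mono) auto
    finally show ?thesis by simp
  qed
  have w_le: "norm (w n x) \<le> (1/2) ^ n" "norm (w n x *\<^sub>R s n) \<le> (1/2) ^ n" for n x
  proof -
    have "0 \<le> w n x * norm (s n)" by (simp add: w0)
    with wle[of n x] w0[of n x] show "norm (w n x) \<le> (1/2) ^ n" "norm (w n x *\<^sub>R s n) \<le> (1/2) ^ n"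
      unfolding norm_scaleR real_norm_def abs_of_nonneg[OF w0] distrib_left mult_1_right by linarith+
  qed
  have contw: "continuous_on S (w n)" for n
    unfolding w_def by (intro continuous_intros eps(1) bounded_linear.continuous_on[OF i]) 
  have small: "w n x * norm (i (s n) - x) \<le> w n x * \<epsilon> x" for n x
  proof (cases "norm (i (s n) - x) \<le> \<epsilon> x")
    case True
    then show ?thesis by (rule mult_left_mono[OF _ w0])
  qed (simp add: w_def)
  define W where "W x = (\<Sum>n. w n x)" for x
  define Z where "Z x = (\<Sum>n. w n x *\<^sub>R s n)" for x
  have geo: "summable (\<lambda>n. (1/2 :: real) ^ n)" by simp
  have sumW: "summable (\<lambda>n. w n x)" for x
    by (rule summable_comparison_test'[OF geo]) (use w_le in auto)
  have sumZ: "summable (\<lambda>n. w n x *\<^sub>R s n)" for x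
    by (rule summable_comparison_test'[OF geo]) (use w_le in auto)
  have "continuous_on S W" "continuous_on S Z"
    unfolding W_def[abs_def] Z_def[abs_def]
    by (intro continuous_on_suminf_geometric continuous_intros contw w_le)+
  have near: "0 < W x \<and> norm (i (Z x) - W x *\<^sub>R x) < W x * \<epsilon> x" if x: "x \<in> S" for x
  proof -
    obtain m where m: "norm (i (s m) - x) < \<epsilon> x" using s_dense eps(2)[OF x] by blast
    then have wm: "w m x > 0" using pos[of "s m"] by (simp add: w_def)
    have Wpos: "W x > 0" unfolding W_def by (rule suminf_pos2[OF sumW w0 wm])
    have sumN: "summable (\<lambda>n. w n x * norm (i (s n) - x))"
      by (rule summable_comparison_test'[OF summable_mult2[OF sumW, of x "\<epsilon> x"]]) (use small w0 in auto)
    have "i (Z x) = (\<Sum>n. w n x *\<^sub>R i (s n))"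
      unfolding Z_def bounded_linear.suminf[OF i sumZ] by (simp add: linear_scale[OF bounded_linear.linear[OF i]])
    moreover have "W x *\<^sub>R x = (\<Sum>n. w n x *\<^sub>R x)"
      unfolding W_def by (rule bounded_linear.suminf[OF bounded_linear_scaleR_left sumW])
    moreover have "summable (\<lambda>n. w n x *\<^sub>R i (s n))"
      using bounded_linear.summable[OF i sumZ[of x]] by (simp add: linear_scale[OF bounded_linear.linear[OF i]])
    moreover have "summable (\<lambda>n. w n x *\<^sub>R x)"
      by (rule bounded_linear.summable[OF bounded_linear_scaleR_left sumW])
    ultimately have "i (Z x) - W x *\<^sub>R x = (\<Sum>n. w n x *\<^sub>R (i (s n) - x))"
      by (simp add: suminf_diff scaleR_diff_right)
    also have "norm \<dots> \<le> (\<Sum>n. w n x * norm (i (s n) - x))"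
      using summable_norm[of "\<lambda>n. w n x *\<^sub>R (i (s n) - x)"] sumN w0 by simp
    finally have le: "norm (i (Z x) - W x *\<^sub>R x) \<le> (\<Sum>n. w n x * norm (i (s n) - x))" .
    \<comment> \<open>All terms are nonnegative and that of index \<open>m\<close> is positive; this
      makes the final estimate strict.\<close>
    have "0 < (\<Sum>n. w n x * \<epsilon> x - w n x * norm (i (s n) - x))"
    proof (rule suminf_pos2)
      show "summable (\<lambda>n. w n x * \<epsilon> x - w n x * norm (i (s n) - x))"
        by (intro summable_diff summable_mult2 sumW sumN)
      show "0 < w m x * \<epsilon> x - w m x * norm (i (s m) - x)" using m wm by simp
    qed (use small in auto)
    also have "\<dots> = W x * \<epsilon> x - (\<Sum>n. w n x * norm (i (s n) - x))"
      unfolding W_def by (simp add: suminf_diff[symmetric] summable_mult2 sumW sumN suminf_mult2[symmetric])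
    finally show ?thesis using le Wpos by simp
  qed
  show ?thesis
  proof (rule that[of "\<lambda>x. inverse (W x) *\<^sub>R Z x"])
    show "continuous_on S (\<lambda>x. inverse (W x) *\<^sub>R Z x)"
      using near by (intro continuous_intros \<open>continuous_on S W\<close> \<open>continuous_on S Z\<close>) (metis less_irrefl)
    fix x assume "x \<in> S"
    note n = near[OF this]
    have "i (inverse (W x) *\<^sub>R Z x) - x = inverse (W x) *\<^sub>R (i (Z x) - W x *\<^sub>R x)"
      using n by (simp add: linear_scale[OF bounded_linear.linear[OF i]] scaleR_diff_right)
    then have "norm (i (inverse (W x) *\<^sub>R Z x) - x) = norm (i (Z x) - W x *\<^sub>R x) / W x"
      using n by (simp only: norm_scaleR) (simp add: divide_inverse_commute)
    then show "norm (i (inverse (W x) *\<^sub>R Z x) - x) < \<epsilon> x"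
      using n by (simp only: pos_divide_less_eq) (simp add: mult.commute)
  qed
qed

text \<open>The distance to the complement of \<open>U\<close> is an admissible radius on
  \<open>M\<close>. Adding the distance to \<open>M\<close>, which is 0 there, makes it positive
  everywhere.\<close>

lemma continuous_radius:
  fixes M :: "'a::metric_space set"
  assumes M: "closed M" and U: "open U" "M \<subseteq> U"
  obtains \<epsilon> :: "'a \<Rightarrow> real" where "continuous_on UNIV \<epsilon>" "\<And>x. \<epsilon> x > 0" "\<And>x. x \<in> M \<Longrightarrow> ball x (\<epsilon> x) \<subseteq> U"
proof (cases "U = UNIV \<or> M = {}")
  \<comment> \<open>\<open>infdist\<close> to the empty set is 0 by convention, so empty
    \<open>M\<close> and empty complement are treated apart.\<close>
  case True
  then show ?thesis by (intro that[of "\<lambda>x. 1"]) auto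
next
  case False
  show ?thesis
  proof (rule that[of "\<lambda>x. infdist x M + infdist x (- U)"])
    show "continuous_on UNIV (\<lambda>x. infdist x M + infdist x (- U))" by (intro continuous_intros)
    show "0 < infdist x M + infdist x (- U)" for x
    proof -
      have "infdist x M \<noteq> 0 \<or> infdist x (- U) \<noteq> 0"
        using in_closed_iff_infdist_zero[OF M, of x] in_closed_iff_infdist_zero[of "- U" x] U False by auto
      then show ?thesis using infdist_nonneg[of x M] infdist_nonneg[of x "- U"] by linarith
    qed
    show "ball x (infdist x M + infdist x (- U)) \<subseteq> U" if "x \<in> M" for x
    proof
      fix y assume "y \<in> ball x (infdist x M + infdist x (- U))"
      then have "dist x y < infdist x (- U)" using that by simp
      then show "y \<in> U" using infdist_le[of y "- U" x] by fastforce
    qed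
  qed
qed

lemma cutoff_function:
  fixes M :: "'a::metric_space set"
  assumes M: "closed M" and U: "open U" "M \<subseteq> U"
  obtains \<rho> :: "'a \<Rightarrow> real" and A S where "continuous_on UNIV \<rho>" "open A" "M \<subseteq> A" "\<And>x. x \<in> A \<Longrightarrow> \<rho> x = 1"
    "closed S" "S \<subseteq> U" "A \<subseteq> U" "\<And>x. x \<notin> S \<Longrightarrow> \<rho> x = 0"
proof (cases "U = UNIV \<or> M = {}")
  case True
  then show ?thesis
  proof
    assume "U = UNIV"
    then show ?thesis by (intro that[of "\<lambda>x. 1" UNIV UNIV]) auto
  next
    assume "M = {}"
    then show ?thesis by (intro that[of "\<lambda>x. 0" "{}" "{}"]) auto
  qed
next
  case False
  define a where "a x = infdist x M" for x
  define b where "b x = infdist x (- U)" for x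
  have ab: "a x + b x > 0" "a x \<ge> 0" "b x \<ge> 0" for x
  proof -
    have "infdist x M \<noteq> 0 \<or> infdist x (- U) \<noteq> 0"
      using in_closed_iff_infdist_zero[OF M, of x] in_closed_iff_infdist_zero[of "- U" x] U False by auto
    then show "a x + b x > 0" "a x \<ge> 0" "b x \<ge> 0" 
      using infdist_nonneg[of x M] infdist_nonneg[of x "- U"] unfolding a_def b_def by linarith+
  qed
  have cont: "continuous_on T a" "continuous_on T b" for T
    unfolding a_def[abs_def] b_def[abs_def] by (intro continuous_intros)+
  have b0: "b x = 0" if "x \<notin> U" for x using that by (simp add: b_def)
  \<comment> \<open>The quotient \<open>a x / (a x + b x)\<close> is 0 on \<open>M\<close> and 1 off
    \<open>U\<close>. The truncation gives 1 below one third and 0 above two thirds, leaving room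
    for \<open>A\<close> and \<open>S\<close>.\<close>
  define \<rho> where "\<rho> x = min 1 (max 0 (2 - 3 * a x / (a x + b x)))" for x
  show ?thesis
  proof (rule that[of \<rho> "{x. 3 * a x < a x + b x}" "{x. 3 * a x \<le> 2 * (a x + b x)}"])
    show "continuous_on UNIV \<rho>"
      unfolding \<rho>_def using ab by (intro continuous_intros cont) (metis less_irrefl)
    show "open {x. 3 * a x < a x + b x}" by (intro open_Collect_less continuous_intros cont)
    show "closed {x. 3 * a x \<le> 2 * (a x + b x)}" by (intro closed_Collect_le continuous_intros cont)
    show "M \<subseteq> {x. 3 * a x < a x + b x}" using ab by (auto simp: a_def) (metis add.left_neutral infdist_zero)
    show "\<rho> x = 1" if "x \<in> {x. 3 * a x < a x + b x}" for x
      using that ab[of x] by (auto simp: \<rho>_def min_def max_def field_simps)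
    show "\<rho> x = 0" if "x \<notin> {x. 3 * a x \<le> 2 * (a x + b x)}" for x
      using that ab[of x] by (auto simp: \<rho>_def min_def max_def field_simps)
    show "{x. 3 * a x \<le> 2 * (a x + b x)} \<subseteq> U"
    proof clarify
      fix x assume "3 * a x \<le> 2 * (a x + b x)"
      then show "x \<in> U" using b0[of x] ab[of x] by fastforce
    qed
    show "{x. 3 * a x < a x + b x} \<subseteq> U"
    proof clarify
      fix x assume "3 * a x < a x + b x"
      then show "x \<in> U" using b0[of x] ab[of x] by fastforce
    qed
  qed
qed

text \<open>A cutoff preserves the value 0 on \<open>M\<close>, and only points where it equals 1
  have to be moved into \<open>M\<close>. It is applied with \<open>C\<close> a single point and
  with \<open>C = M\<close>.\<close>

lemma extend_correction:
  fixes i :: "'y::real_normed_vector \<Rightarrow> 'x::real_normed_vector"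
  assumes C: "closed C" "C \<subseteq> U" and U: "open U"
    and \<tau>: "continuous_on U \<tau>" "\<And>x. x \<in> M \<inter> U \<Longrightarrow> \<tau> x = 0" "\<And>x. x \<in> U \<Longrightarrow> x + i (\<tau> x) \<in> M"
  obtains \<sigma> A where "continuous_on UNIV \<sigma>" "\<And>x. x \<in> M \<Longrightarrow> \<sigma> x = 0" "open A" "C \<subseteq> A" 
    "\<And>x. x \<in> A \<Longrightarrow> x + i (\<sigma> x) \<in> M"
proof -
  obtain \<rho> :: "'x \<Rightarrow> real" and A S where \<rho>: "continuous_on UNIV \<rho>" "open A" "C \<subseteq> A" "\<And>x. x \<in> A \<Longrightarrow> \<rho> x = 1"
    "closed S" "S \<subseteq> U" "A \<subseteq> U" "\<And>x. x \<notin> S \<Longrightarrow> \<rho> x = 0"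
    using cutoff_function[OF C(1) U C(2)] by metis
  define \<sigma> where "\<sigma> x = (if x \<in> U then \<rho> x *\<^sub>R \<tau> x else 0)" for x
  have "continuous_on (U \<union> - S) \<sigma>"
  proof (rule continuous_on_open_Un[OF U])
    show "open (- S)" using \<rho>(5) by auto
    show "continuous_on U \<sigma>"
      by (rule continuous_on_eq[of _ "\<lambda>x. \<rho> x *\<^sub>R \<tau> x"])
        (auto simp: \<sigma>_def intro!: continuous_intros \<tau>(1) continuous_on_subset[OF \<rho>(1)])
    show "continuous_on (- S) \<sigma>"
      by (rule continuous_on_eq[of _ "\<lambda>x. 0"]) (auto simp: \<sigma>_def \<rho>(8))
  qed
  moreover have "U \<union> - S = UNIV" using \<rho>(6) by auto
  ultimately show ?thesis
    using \<rho>(2,3,4,7) \<tau>(2,3) by (intro that[of \<sigma> A]) (auto simp: \<sigma>_def subset_iff)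
qed

text \<open>A Lindelof argument: among countably many balls, each one on which some correction works
  is given such a correction.\<close>

lemma countable_corrections:
  fixes i :: "'y::real_normed_vector \<Rightarrow> 'x::real_normed_vector"
  assumes sep: "separable_space (euclidean :: 'x topology)"
    and loc: "\<And>p. p \<in> M \<Longrightarrow> \<exists>\<sigma> A. continuous_on UNIV \<sigma> \<and> (\<forall>x\<in>M. \<sigma> x = 0) \<and> open A \<and> p \<in> A \<and> (\<forall>x\<in>A. x + i (\<sigma> x) \<in> M)"
  obtains \<sigma> :: "nat \<Rightarrow> 'x \<Rightarrow> 'y" where "\<And>n. continuous_on UNIV (\<sigma> n)" "\<And>n x. x \<in> M \<Longrightarrow> \<sigma> n x = 0"
    "\<And>p. p \<in> M \<Longrightarrow> \<exists>n A. open A \<and> p \<in> A \<and> (\<forall>x\<in>A. x + i (\<sigma> n x) \<in> M)"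
proof -
  obtain s :: "nat \<Rightarrow> 'x" where s: "\<And>x e. e > 0 \<Longrightarrow> \<exists>n. dist (s n) x < e"
    using separable_euclidean_sequence[OF sep] by metis
  define B where "B = (\<lambda>(m, k). ball (s m) (1 / real (Suc k)))"
  define good where "good mk \<sigma> \<longleftrightarrow> continuous_on UNIV \<sigma> \<and> (\<forall>x\<in>M. \<sigma> x = 0) \<and> (\<forall>x\<in>B mk. x + i (\<sigma> x) \<in> M)" for mk and \<sigma> :: "'x \<Rightarrow> 'y"
  \<comment> \<open>The default 0 is continuous and vanishes on \<open>M\<close>, so the remaining
    balls do no harm in the composition.\<close>
  define f where "f mk = (if \<exists>\<sigma>. good mk \<sigma> then SOME \<sigma>. good mk \<sigma> else (\<lambda>x. 0))" for mk
  have f: "good mk (f mk)" if "good mk \<sigma>" for mk \<sigma>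
    using that someI[of "good mk"] unfolding f_def by auto
  have f': "continuous_on UNIV (f mk) \<and> (\<forall>x\<in>M. f mk x = 0)" for mk
  proof (cases "\<exists>\<sigma>. good mk \<sigma>")
    case True
    then show ?thesis using f unfolding good_def by blast
  qed (simp add: f_def)
  show ?thesis
  proof (rule that[of "\<lambda>n. f (prod_decode n)"])
    fix p assume "p \<in> M"
    then obtain \<sigma> A where A: "continuous_on UNIV \<sigma>" "\<forall>x\<in>M. \<sigma> x = 0" "open A" "p \<in> A" "\<forall>x\<in>A. x + i (\<sigma> x) \<in> M"
      using loc by metis
    obtain r where r: "r > 0" "ball p r \<subseteq> A" using A(3,4) openE by blast
    obtain k where k: "1 / real (Suc k) < r / 2" using r(1) reals_Archimedean[of "r / 2"] by (auto simp: inverse_eq_divide)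
    obtain m where m: "dist (s m) p < 1 / real (Suc k)" using s[of "1 / real (Suc k)" p] by auto
    have "B (m, k) \<subseteq> A"
    proof
      fix x assume "x \<in> B (m, k)"
      then have "dist p x < r" using dist_triangle[of p x "s m"] m k by (simp add: B_def dist_commute)
      then show "x \<in> A" using r by auto
    qed
    then have "good (m, k) \<sigma>" using A by (auto simp: good_def)
    then have "good (m, k) (f (m, k))" by (rule f)
    moreover have "open (B (m, k))" "p \<in> B (m, k)" using m by (auto simp: B_def)
    ultimately show "\<exists>n A. open A \<and> p \<in> A \<and> (\<forall>x\<in>A. x + i (f (prod_decode n) x) \<in> M)"
      unfolding good_def by (intro exI[of _ "prod_encode (m, k)"] exI[of _ "B (m, k)"]) simp
  qed (use f' in auto)
qed

text \<open>Infinite composition of the maps \<open>x \<mapsto> x + i (\<sigma> n x)\<close>.  All of them fix \<open>M\<close>, so near a point of \<open>M\<close> the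
  compositions become stationary as soon as one of them has reached \<open>M\<close>.\<close>

lemma global_correction:
  fixes i :: "'y::real_normed_vector \<Rightarrow> 'x::real_normed_vector"
  assumes sep: "separable_space (euclidean :: 'x topology)" and i: "bounded_linear i" and M: "closed M"
    and loc: "\<And>p. p \<in> M \<Longrightarrow> \<exists>\<sigma> A. continuous_on UNIV \<sigma> \<and> (\<forall>x\<in>M. \<sigma> x = 0) \<and> open A \<and> p \<in> A \<and> (\<forall>x\<in>A. x + i (\<sigma> x) \<in> M)"
  obtains \<sigma> A where "continuous_on UNIV \<sigma>" "\<And>x. x \<in> M \<Longrightarrow> \<sigma> x = 0" "open A" "M \<subseteq> A" 
    "\<And>x. x \<in> A \<Longrightarrow> x + i (\<sigma> x) \<in> M"
proof -
  obtain \<sigma> :: "nat \<Rightarrow> 'x \<Rightarrow> 'y" where \<sigma>: "\<And>n. continuous_on UNIV (\<sigma> n)" "\<And>n x. x \<in> M \<Longrightarrow> \<sigma> n x = 0"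
    "\<And>p. p \<in> M \<Longrightarrow> \<exists>n A. open A \<and> p \<in> A \<and> (\<forall>x\<in>A. x + i (\<sigma> n x) \<in> M)"
    using countable_corrections[OF sep loc] by metis
  have i0: "i 0 = 0" using i by (simp add: bounded_linear.linear linear_0)
  \<comment> \<open>\<open>S n\<close> is the Y-part of the composition of the first
    \<open>n\<close> maps, which is \<open>x \<mapsto> x + i (S n x)\<close>.\<close>
  define S where "S = rec_nat (\<lambda>x. 0) (\<lambda>n T x. T x + \<sigma> n (x + i (T x)))"
  have S: "S 0 x = 0" "S (Suc n) x = S n x + \<sigma> n (x + i (S n x))" for n x by (simp_all add: S_def)
  have contS: "continuous_on UNIV (S n)" for n
  proof (induction n)
    case (Suc n)
    have "continuous_on UNIV (\<lambda>x. \<sigma> n (x + i (S n x)))"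
      by (rule continuous_on_compose2[OF \<sigma>(1)[of n]]) (auto intro!: continuous_intros Suc bounded_linear.continuous_on[OF i])
    then show ?case unfolding S[abs_def] by (intro continuous_intros Suc)
  qed (simp add: S[abs_def])
  have contF: "continuous_on UNIV (\<lambda>x. x + i (S n x))" for n
    by (intro continuous_intros contS bounded_linear.continuous_on[OF i])
  have S_M: "S n x = 0" if "x \<in> M" for n x using that by (induction n) (auto simp: S \<sigma>(2) i0)
  \<comment> \<open>The open set on which the first \<open>n\<close> maps have already reached
    \<open>M\<close>.\<close>
  define O' where "O' n = interior {x. x + i (S n x) \<in> M}" for n
  have O': "x + i (S n x) \<in> M" if "x \<in> O' n" for x n using that interior_subset unfolding O'_def by fastforce
  have stable: "S (n + k) x = S n x" if "x \<in> O' n" for n k x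
    using O'[OF that] by (induction k) (auto simp: S \<sigma>(2))
  have cover: "\<exists>n. p \<in> O' n" if p: "p \<in> M" for p
  proof -
    obtain n A where A: "open A" "p \<in> A" "\<forall>x\<in>A. x + i (\<sigma> n x) \<in> M" using \<sigma>(3)[OF p] by blast
    have "open ((\<lambda>x. x + i (S n x)) -` A)"
      using contF A(1) by (metis open_vimage)
    moreover have "p \<in> (\<lambda>x. x + i (S n x)) -` A" using A(2) S_M[OF p] i0 by simp
    moreover have "x + i (S (Suc n) x) \<in> M" if "x \<in> (\<lambda>x. x + i (S n x)) -` A" for x
    proof -
      have "(x + i (S n x)) + i (\<sigma> n (x + i (S n x))) \<in> M" using A(3) that by auto
      then show ?thesis by (simp add: S linear_add[OF bounded_linear.linear[OF i]] add.assoc)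
    qed
    ultimately have "p \<in> O' (Suc n)" unfolding O'_def by (intro interiorI) auto
    then show ?thesis ..
  qed
  \<comment> \<open>By stability any \<open>n\<close> with \<open>x \<in> O' n\<close> gives the
    same value, so \<open>\<tau>\<close> is continuous on each \<open>O' n\<close>.\<close>
  define \<tau> where "\<tau> x = S (LEAST n. x \<in> O' n) x" for x
  have \<tau>: "\<tau> x = S n x" if "x \<in> O' n" for x n
    using stable[OF LeastI[of "\<lambda>n. x \<in> O' n", OF that], of "n - (LEAST n. x \<in> O' n)"] Least_le[of "\<lambda>n. x \<in> O' n", OF that]
    by (simp add: \<tau>_def)
  have "continuous_on (\<Union>n. O' n) \<tau>"
  proof (rule continuous_on_open_UN)
    show "continuous_on (O' n) \<tau>" for n
      by (rule continuous_on_eq[OF continuous_on_subset[OF contS[of n]]]) (auto simp: \<tau>)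
  qed (auto simp: O'_def)
  moreover have "\<tau> x = 0" if "x \<in> M \<inter> (\<Union>n. O' n)" for x using that by (auto simp: \<tau> S_M)
  moreover have "x + i (\<tau> x) \<in> M" if "x \<in> (\<Union>n. O' n)" for x using that O' by (auto simp: \<tau>)
  moreover have "M \<subseteq> (\<Union>n. O' n)" using cover by blast
  moreover have "open (\<Union>n. O' n)" by (auto simp: O'_def)
  ultimately show ?thesis
    using extend_correction[OF M, of "\<Union>n. O' n" \<tau> M i] that by metis
qed

section \<open>Preimages of submanifolds\<close>

text \<open>The derivative of the inverse is a right inverse of \<open>\<Lambda>\<close> by the
  chain rule. Surjectivity carries density from the range of \<open>i\<close> to that of
  \<open>\<Lambda> \<circ> i\<close>.\<close>

lemma diffeomorphism_derivative_surj:
  fixes \<phi> :: "'a::real_normed_vector \<Rightarrow> 'b::real_normed_vector"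
  assumes "smooth_diffeomorphism U V \<phi>" "open U" "open V" "p \<in> U" and \<Lambda>: "(\<phi> has_derivative \<Lambda>) (at p)"
  shows "surj \<Lambda>"
proof -
  define \<kappa> where "\<kappa> = inv_into U \<phi>"
  have bij: "bij_betw \<phi> U V" and \<kappa>: "smooth_on V \<kappa>"
    using assms(1) by (auto simp: smooth_diffeomorphism_def \<kappa>_def)
  have pV: "\<phi> p \<in> V" using bij assms(4) bij_betwE by blast
  have inv: "\<kappa> (\<phi> p) = p" using bij assms(4) by (simp add: \<kappa>_def bij_betw_inv_into_left)
  obtain \<kappa>' where \<kappa>': "(\<kappa> has_derivative \<kappa>') (at (\<phi> p))"
    using smooth_on_has_derivative[OF assms(3) \<kappa> pV] by blast
  have "((\<lambda>z. \<phi> (\<kappa> z)) has_derivative (\<lambda>v. \<Lambda> (\<kappa>' v))) (at (\<phi> p))"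
    using has_derivative_compose[OF \<kappa>', of \<phi> \<Lambda>] \<Lambda> inv by simp
  moreover have "((\<lambda>z. \<phi> (\<kappa> z)) has_derivative (\<lambda>v. v)) (at (\<phi> p))"
  proof (rule has_derivative_transform_within_open[OF has_derivative_ident assms(3) pV])
    show "z = \<phi> (\<kappa> z)" if "z \<in> V" for z using bij that by (simp add: \<kappa>_def bij_betw_inv_into_right)
  qed
  ultimately have "(\<lambda>v. \<Lambda> (\<kappa>' v)) = (\<lambda>v. v)" by (rule has_derivative_unique)
  then have "\<Lambda> (\<kappa>' v) = v" for v by (rule fun_cong)
  then show ?thesis by (metis surjI)
qed

lemma dense_range_compose_surj:
  fixes i :: "'y::real_normed_vector \<Rightarrow> 'x::real_normed_vector"
  assumes "closure (range i) = UNIV" "bounded_linear \<Lambda>" "surj \<Lambda>"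
  shows "closure (range (\<lambda>y. \<Lambda> (i y))) = UNIV"
proof -
  have "\<Lambda> ` closure (range i) \<subseteq> closure (\<Lambda> ` range i)"
    by (rule image_closure_subset[where S="range i"]) (auto intro!: linear_continuous_on assms closure_subset)
  then show ?thesis using assms(1,3) by (auto simp: image_image)
qed

text \<open>\<open>T \<circ> \<phi>\<close> is a defining function for \<open>M\<close> near
  \<open>p\<close> with values in Y. The last identity makes
  \<open>T \<circ> \<Lambda> \<circ> i\<close> a projection in Y and
  \<open>i \<circ> T \<circ> \<Lambda>\<close> one in X.\<close>

lemma transversal_slice_chart:
  fixes i :: "'y::real_normed_vector \<Rightarrow> 'x::real_normed_vector"
  assumes M: "finite_codim_smooth_submanifold M" and p: "p \<in> M"
    and i: "bounded_linear i" "closure (range i) = UNIV"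
  obtains U \<phi> \<Lambda> T where "open U" "p \<in> U" "smooth_on U \<phi>" "(\<phi> has_derivative \<Lambda>) (at p)"
    "bounded_linear \<Lambda>" "bounded_linear (T :: 'x \<Rightarrow> 'y)" "\<And>x. x \<in> U \<Longrightarrow> T (\<phi> x) = 0 \<longleftrightarrow> x \<in> M" 
    "\<And>x. T (\<Lambda> (i (T x))) = T x"
proof -
  obtain E :: "'x set" and U V \<phi> where E: "finite_codim_subspace E" and ch: "open U" "p \<in> U" "open V" "smooth_diffeomorphism U V \<phi>" "\<phi> ` (U \<inter> M) = V \<inter> E"
    using M p unfolding finite_codim_smooth_submanifold_def slice_chart_at_def by blast
  have \<phi>: "smooth_on U \<phi>" "bij_betw \<phi> U V" using ch(4) by (auto simp: smooth_diffeomorphism_def)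
  obtain \<Lambda> where \<Lambda>: "(\<phi> has_derivative \<Lambda>) (at p)" using smooth_on_has_derivative[OF ch(1) \<phi>(1) ch(2)] .
  have bl: "bounded_linear \<Lambda>" using \<Lambda> by (rule has_derivative_bounded_linear)
  have "closure (range (\<lambda>y. \<Lambda> (i y))) = UNIV"
    by (rule dense_range_compose_surj[OF i(2) bl diffeomorphism_derivative_surj[OF ch(4,1,3,2) \<Lambda>]])
  from transversal_right_inverse[OF bounded_linear_compose[OF bl i(1)] this E]
  obtain T :: "'x \<Rightarrow> 'y" where T: "bounded_linear T" "\<And>x. T x = 0 \<longleftrightarrow> x \<in> E" "\<And>x. T (\<Lambda> (i (T x))) = T x" by metis
  have "\<phi> x \<in> E \<longleftrightarrow> x \<in> M" if "x \<in> U" for x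
  proof
    assume "\<phi> x \<in> E"
    then have "\<phi> x \<in> \<phi> ` (U \<inter> M)" using ch(5) \<phi>(2) that bij_betwE by blast
    then show "x \<in> M" using \<phi>(2) that unfolding bij_betw_def by (auto dest: inj_onD)
  qed (use ch(5) that in blast)
  with that[OF ch(1,2) \<phi>(1) \<Lambda> bl T(1) _ T(3)] T(2) show ?thesis by blast
qed

text \<open>In the chart the submanifold is the zero set of \<open>T \<circ> \<phi>\<close>, and \<open>\<psi>\<close> replaces the
  \<open>T \<circ> \<Lambda> \<circ> i\<close>-component of the identity by this function.\<close>

lemma preimage_smooth_submanifold:
  fixes i :: "'y::banach \<Rightarrow> 'x::real_normed_vector"
  assumes M: "finite_codim_smooth_submanifold M" 
    and i: "bounded_linear i" "closure (range i) = UNIV"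
  shows "smooth_submanifold (i -` M)"
  unfolding smooth_submanifold_def
proof
  fix q assume "q \<in> i -` M"
  then have iq: "i q \<in> M" by simp
  obtain U \<phi> \<Lambda> and T :: "'x \<Rightarrow> 'y" where U: "open U" "i q \<in> U" and \<phi>: "smooth_on U \<phi>" and \<Lambda>: "(\<phi> has_derivative \<Lambda>) (at (i q))"
    "bounded_linear \<Lambda>" and T: "bounded_linear T" "\<And>x. x \<in> U \<Longrightarrow> T (\<phi> x) = 0 \<longleftrightarrow> x \<in> M" "\<And>x. T (\<Lambda> (i (T x))) = T x"
    using transversal_slice_chart[OF M iq i] by metis
  define P where "P y = T (\<Lambda> (i y))" for y
  have P: "bounded_linear P"
    unfolding P_def[abs_def] by (rule bounded_linear_compose[OF T(1) bounded_linear_compose[OF \<Lambda>(2) i(1)]])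
  note linP = bounded_linear.linear[OF P]
  have PT: "P (T x) = T x" for x by (simp add: P_def T(3))
  have PP: "P (P y) = P y" for y using PT[of "\<Lambda> (i y)"] by (simp add: P_def)
  define h where "h y = T (\<phi> (i y)) - P y" for y
  have op: "open (i -` U)" using U i by (intro continuous_open_vimage) (auto simp: linear_continuous_at)
  have h: "smooth_on (i -` U) h"
    using smooth_on_add[OF op smooth_on_compose_linear[OF U(1) \<phi> T(1) i(1)] smooth_on_linear[OF op bounded_linear_minus[OF P]]]
    by (simp add: h_def[abs_def])
  have "((\<lambda>y. T (\<phi> (i y)) - P y) has_derivative (\<lambda>v. T (\<Lambda> (i v)) - P v)) (at q)"
    by (intro has_derivative_diff bounded_linear.has_derivative[OF T(1)] bounded_linear_imp_has_derivative[OF P]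
        has_derivative_compose[OF bounded_linear_imp_has_derivative[OF i(1)] \<Lambda>(1)])
  then have hq: "(h has_derivative (\<lambda>v. 0)) (at q)" by (simp add: h_def[abs_def] P_def)
  obtain r where r: "r > 0" "ball q r \<subseteq> i -` U"
    "\<And>x. x \<in> ball q r \<Longrightarrow> \<exists>h'. (h has_derivative h') (at x) \<and> (\<forall>v. norm (h' v) \<le> norm v / 2)"
    using smooth_on_small_derivative_ball[OF op _ h hq] U(2) by auto
  define \<psi> where "\<psi> y = y + h y" for y
  have \<psi>: "open (\<psi> ` ball q r)" "smooth_diffeomorphism (ball q r) (\<psi> ` ball q r) \<psi>"
    using smooth_diffeomorphism_near_identity[OF open_ball convex_ball smooth_on_subset[OF h r(2)] r(3)]
    unfolding \<psi>_def[abs_def] by blast+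
  define E where "E = {y. P y = 0}"
  \<comment> \<open>\<open>P\<close> is a projection that fixes the range of \<open>T\<close>, so
    the old component cancels and the defining function of the preimage remains.\<close>
  have "P (\<psi> y) = T (\<phi> (i y))" for y
    by (simp add: \<psi>_def h_def linear_add[OF linP] linear_diff[OF linP] PT PP)
  then have "\<psi> y \<in> E \<longleftrightarrow> y \<in> i -` M" if "y \<in> ball q r" for y
    using T(2)[of "i y"] that r(2) by (auto simp: E_def)
  then have "\<psi> ` (ball q r \<inter> i -` M) = \<psi> ` ball q r \<inter> E" by blast
  moreover have "complemented_subspace E"
    unfolding complemented_subspace_def
  proof (intro conjI exI[of _ "{y. P y = y}"] allI)
    have contP: "continuous_on UNIV P" by (rule linear_continuous_on[OF P])
    show "subspace E" "subspace {y. P y = y}"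
      by (auto simp: E_def subspace_def linear_add[OF linP] linear_scale[OF linP] linear_0[OF linP])
    show "closed E" "closed {y. P y = y}"
      unfolding E_def by (intro closed_Collect_eq contP continuous_on_const continuous_on_id)+
    show "E \<inter> {y. P y = y} = {0}" by (auto simp: E_def linear_0[OF linP])
    show "\<exists>u\<in>E. \<exists>v\<in>{y. P y = y}. x = u + v" for x
      by (intro bexI[of _ "x - P x"] bexI[of _ "P x"]) (auto simp: E_def linear_diff[OF linP] PP)
  qed
  ultimately show "\<exists>E. complemented_subspace E \<and> slice_chart_at (i -` M) E q"
    using r(1) \<psi> unfolding slice_chart_at_def by (intro exI[of _ E] conjI exI[of _ "ball q r"] exI[of _ "\<psi> ` ball q r"] exI[of _ \<psi>]) auto
qed

text \<open>The retraction is \<open>\<kappa> \<circ> g\<close>: \<open>g\<close> removes the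
  component \<open>i (Q x)\<close>, and on \<open>M\<close> it agrees with \<open>\<psi>\<close>, so
  points of \<open>M\<close> are fixed. Since \<open>\<psi>\<close> changes points only by elements
  of the range of \<open>i\<close>, the displacement comes from Y.\<close>

lemma local_correction:
  fixes i :: "'y::real_normed_vector \<Rightarrow> 'x::banach"
  assumes M: "finite_codim_smooth_submanifold M" and p: "p \<in> M"
    and i: "bounded_linear i" "closure (range i) = UNIV"
  obtains W \<tau> where "open W" "p \<in> W" "continuous_on W \<tau>" "\<And>x. x \<in> M \<inter> W \<Longrightarrow> \<tau> x = (0 :: 'y)" "\<And>x. x \<in> W \<Longrightarrow> x + i (\<tau> x) \<in> M"
proof -
  obtain U \<phi> \<Lambda> and T :: "'x \<Rightarrow> 'y" where U: "open U" "p \<in> U" and \<phi>: "smooth_on U \<phi>" and \<Lambda>: "(\<phi> has_derivative \<Lambda>) (at p)"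
    "bounded_linear \<Lambda>" and T: "bounded_linear T" "\<And>x. x \<in> U \<Longrightarrow> T (\<phi> x) = 0 \<longleftrightarrow> x \<in> M" "\<And>x. T (\<Lambda> (i (T x))) = T x"
    using transversal_slice_chart[OF M p i] by metis
  define Q where "Q x = T (\<Lambda> x)" for x
  have Q: "bounded_linear Q" unfolding Q_def[abs_def] by (rule bounded_linear_compose[OF T(1) \<Lambda>(2)])
  have iQ: "bounded_linear (\<lambda>x. i (Q x))" by (rule bounded_linear_compose[OF i(1) Q])
  have iT: "bounded_linear (\<lambda>x. i (T x))" by (rule bounded_linear_compose[OF i(1) T(1)])
  note linQ = bounded_linear.linear[OF Q] and lini = bounded_linear.linear[OF i(1)]
  have QT: "Q (i (T x)) = T x" for x by (simp add: Q_def T(3))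
  have QQ: "Q (i (Q x)) = Q x" for x using QT[of "\<Lambda> x"] by (simp add: Q_def)
  define h where "h x = i (T (\<phi> x)) - i (Q x)" for x
  have h: "smooth_on U h"
    using smooth_on_add[OF U(1) smooth_on_compose_linear[OF U(1) \<phi> iT bounded_linear_ident, simplified] smooth_on_linear[OF U(1) bounded_linear_minus[OF iQ]]]
    by (simp add: h_def[abs_def])
  have "((\<lambda>x. i (T (\<phi> x)) - i (Q x)) has_derivative (\<lambda>v. i (T (\<Lambda> v)) - i (Q v))) (at p)"
    by (intro has_derivative_diff bounded_linear.has_derivative[OF iT] bounded_linear_imp_has_derivative[OF iQ] \<Lambda>(1))
  then have hp: "(h has_derivative (\<lambda>v. 0)) (at p)" by (simp add: h_def[abs_def] Q_def)
  obtain r where r: "r > 0" "ball p r \<subseteq> U"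
    "\<And>x. x \<in> ball p r \<Longrightarrow> \<exists>h'. (h has_derivative h') (at x) \<and> (\<forall>v. norm (h' v) \<le> norm v / 2)"
    using smooth_on_small_derivative_ball[OF U h hp] by metis
  define \<psi> where "\<psi> y = y + h y" for y
  define \<kappa> where "\<kappa> = inv_into (ball p r) \<psi>"
  have \<psi>: "open (\<psi> ` ball p r)" "smooth_diffeomorphism (ball p r) (\<psi> ` ball p r) \<psi>"
    using smooth_diffeomorphism_near_identity[OF open_ball convex_ball smooth_on_subset[OF h r(2)] r(3)]
    unfolding \<psi>_def[abs_def] by blast+
  have \<kappa>: "\<kappa> z \<in> ball p r" "\<psi> (\<kappa> z) = z" if "z \<in> \<psi> ` ball p r" for z
    unfolding \<kappa>_def using inv_into_into[OF that] f_inv_into_f[OF that] by auto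
  have \<kappa>\<psi>: "\<kappa> (\<psi> x) = x" if "x \<in> ball p r" for x
    using \<psi>(2) that unfolding \<kappa>_def smooth_diffeomorphism_def by (meson bij_betw_inv_into_left)
  have cont: "continuous_on (\<psi> ` ball p r) \<kappa>"
    using \<psi> smooth_on_continuous_on unfolding smooth_diffeomorphism_def \<kappa>_def by blast
  define g where "g x = x - i (Q x)" for x
  have contg: "continuous_on A g" for A
    unfolding g_def[abs_def] by (intro continuous_intros linear_continuous_on[OF iQ])
  have \<psi>g: "\<psi> x = g x" if "x \<in> M" "x \<in> ball p r" for x
    using T(2)[of x] that r(2) by (auto simp: \<psi>_def h_def g_def linear_0[OF lini])
  define W where "W = ball p r \<inter> g -` (\<psi> ` ball p r)"
  define \<tau> where "\<tau> x = Q (\<kappa> (g x) - x)" for x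
  show ?thesis
  proof (rule that[of W \<tau>])
    show "open W" unfolding W_def using contg[of UNIV] \<psi>(1) by (intro open_Int open_ball open_vimage)
    show "p \<in> W" using \<psi>g[OF p] r(1) by (auto simp: W_def intro!: image_eqI[of _ _ p])
    show "continuous_on W \<tau>"
      unfolding \<tau>_def[abs_def]
      by (intro bounded_linear.continuous_on[OF Q] continuous_intros continuous_on_compose2[OF cont contg]) (auto simp: W_def)
    show "\<tau> x = 0" if "x \<in> M \<inter> W" for x
      using \<kappa>\<psi>[of x] \<psi>g[of x] that by (auto simp: \<tau>_def W_def linear_0[OF linQ])
    show "x + i (\<tau> x) \<in> M" if x: "x \<in> W" for x
    proof -
      define z where "z = \<kappa> (g x)"
      have z: "z \<in> ball p r" "\<psi> z = g x" using \<kappa>[of "g x"] x by (auto simp: z_def W_def)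
      then have eq: "z + i (T (\<phi> z)) - i (Q z) = x - i (Q x)" by (simp add: \<psi>_def h_def g_def add_diff_eq)
      \<comment> \<open>\<open>Q\<close> annihilates the right side and cancels the
        \<open>z\<close>-terms on the left except \<open>T (\<phi> z)\<close>, so \<open>z\<close>
        lies on \<open>M\<close>.\<close>
      then have "Q (z + i (T (\<phi> z)) - i (Q z)) = Q (x - i (Q x))" by simp
      then have "T (\<phi> z) = 0" by (simp add: linear_add[OF linQ] linear_diff[OF linQ] QT QQ)
      then have "z \<in> M" using T(2)[of z] z(1) r(2) by blast
      moreover have "x + i (\<tau> x) = z"
        using eq \<open>T (\<phi> z) = 0\<close> by (simp add: \<tau>_def z_def[symmetric] linear_diff[OF linQ] linear_diff[OF lini] linear_0[OF lini] algebra_simps)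
      ultimately show ?thesis by simp
    qed
  qed
qed

lemma normal_correction:
  fixes i :: "'y::real_normed_vector \<Rightarrow> 'x::banach"
  assumes sep: "separable_space (euclidean :: 'x topology)"
    and M: "finite_codim_smooth_submanifold M" "closed M"
    and i: "bounded_linear i" "closure (range i) = UNIV"
  obtains \<sigma> :: "'x \<Rightarrow> 'y" and A where "continuous_on UNIV \<sigma>" "\<And>x. x \<in> M \<Longrightarrow> \<sigma> x = 0" "open A" "M \<subseteq> A" 
    "\<And>x. x \<in> A \<Longrightarrow> x + i (\<sigma> x) \<in> M"
proof -
  have "\<exists>(\<sigma> :: 'x \<Rightarrow> 'y) A. continuous_on UNIV \<sigma> \<and> (\<forall>x\<in>M. \<sigma> x = 0) \<and> open A \<and> p \<in> A \<and> (\<forall>x\<in>A. x + i (\<sigma> x) \<in> M)"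
    if p: "p \<in> M" for p
  proof -
    obtain W and \<tau> :: "'x \<Rightarrow> 'y" where W: "open W" "p \<in> W" "continuous_on W \<tau>" "\<And>x. x \<in> M \<inter> W \<Longrightarrow> \<tau> x = 0" "\<And>x. x \<in> W \<Longrightarrow> x + i (\<tau> x) \<in> M"
      using local_correction[OF M(1) p i] by metis
    have "{p} \<subseteq> W" using W(2) by simp
    from extend_correction[OF closed_singleton this W(1,3), of M i] W(4,5)
    obtain \<sigma> A where "continuous_on UNIV \<sigma>" "\<And>x. x \<in> M \<Longrightarrow> \<sigma> x = 0" "open A" "{p} \<subseteq> A" "\<And>x. x \<in> A \<Longrightarrow> x + i (\<sigma> x) \<in> M"
      by metis
    then show ?thesis by (intro exI[of _ \<sigma>] exI[of _ A]) auto
  qed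
  from global_correction[OF sep i(1) M(2) this] that show ?thesis by metis
qed

lemma homotopic_with_euclideanI:
  fixes h :: "real \<times> 'a::topological_space \<Rightarrow> 'b::topological_space"
  assumes "continuous_on ({0..1} \<times> S) h" "h ` ({0..1} \<times> S) \<subseteq> T"
    and "\<And>x. h (0, x) = f x" "\<And>x. h (1, x) = g x" "\<And>t. t \<in> {0..1} \<Longrightarrow> P (\<lambda>x. h (t, x))"
  shows "homotopic_with P (top_of_set S) (top_of_set T) f g"
  unfolding homotopic_with_def
  using assms by (intro exI[of _ h]) (auto simp: prod_topology_subtopology_eu continuous_map_subtopology_eu)

section \<open>Homotopy equivalences\<close>

text \<open>With \<open>i (g x)\<close> closer to \<open>x\<close> than the complement of
  \<open>U\<close>, the segment between them stays in \<open>U\<close>. The segment from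
  \<open>g (i y)\<close> to \<open>y\<close> is mapped onto one of these by \<open>i\<close>, hence
  stays in the preimage.\<close>

lemma preimage_open_homotopy_equivalence:
  fixes i :: "'y::banach \<Rightarrow> 'x::banach"
  assumes sep: "separable_space (euclidean :: 'y topology)"
    and i: "bounded_linear i" "closure (range i) = UNIV" and U: "open U"
  shows "homotopy_equivalence (top_of_set (i -` U)) (top_of_set U) i"
proof -
  have conti: "continuous_on A i" for A by (rule linear_continuous_on[OF i(1)])
  note lini = bounded_linear.linear[OF i(1)]
  \<comment> \<open>For an empty complement \<open>infdist\<close> would be 0, so a positive
    constant is used instead.\<close>
  define \<epsilon> where "\<epsilon> x = (if U = UNIV then 1 else infdist x (- U))" for x
  have "continuous_on U \<epsilon>"
    by (cases "U = UNIV") (auto simp: \<epsilon>_def[abs_def] intro!: continuous_intros)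
  moreover have "\<epsilon> x > 0" if "x \<in> U" for x
    using that U in_closed_iff_infdist_zero[of "- U" x] infdist_nonneg[of x "- U"] by (auto simp: \<epsilon>_def less_le)
  ultimately obtain g where g: "continuous_on U g" "\<And>x. x \<in> U \<Longrightarrow> norm (i (g x) - x) < \<epsilon> x"
    using dense_range_approximation[OF sep i, of U \<epsilon>] by metis
  have seg: "(1 - t) *\<^sub>R i (g x) + t *\<^sub>R x \<in> U" if "x \<in> U" "t \<in> {0..1}" for x t
  proof (rule ccontr)
    assume n: "(1 - t) *\<^sub>R i (g x) + t *\<^sub>R x \<notin> U"
    have "dist x ((1 - t) *\<^sub>R i (g x) + t *\<^sub>R x) = norm ((1 - t) *\<^sub>R (i (g x) - x))"
      unfolding dist_norm by (subst norm_minus_commute) (simp add: algebra_simps)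
    also have "\<dots> \<le> norm (i (g x) - x)" using that by (simp add: mult_left_le_one_le)
    also have "\<dots> < \<epsilon> x" by (rule g(2)[OF that(1)])
    finally show False using infdist_le[of "(1 - t) *\<^sub>R i (g x) + t *\<^sub>R x" "- U" x] n by (auto simp: \<epsilon>_def split: if_splits)
  qed
  have gU: "g x \<in> i -` U" if "x \<in> U" for x using seg[OF that, of 0] by simp
  have iseg: "i ((1 - t) *\<^sub>R g (i y) + t *\<^sub>R y) = (1 - t) *\<^sub>R i (g (i y)) + t *\<^sub>R i y" for t y
    by (simp add: linear_add[OF lini] linear_scale[OF lini])
  have "continuous_map (top_of_set (i -` U)) (top_of_set U) i"
    using conti by (auto simp: continuous_map_subtopology_eu)
  moreover have "continuous_map (top_of_set U) (top_of_set (i -` U)) g"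
    using g(1) gU by (auto simp: continuous_map_subtopology_eu)
  moreover have "homotopic_with (\<lambda>_. True) (top_of_set (i -` U)) (top_of_set (i -` U)) (g \<circ> i) id"
  proof (rule homotopic_with_euclideanI[where h="\<lambda>(t, y). (1 - t) *\<^sub>R g (i y) + t *\<^sub>R y"])
    show "continuous_on ({0..1} \<times> i -` U) (\<lambda>(t, y). (1 - t) *\<^sub>R g (i y) + t *\<^sub>R y)"
      unfolding case_prod_unfold
      by (intro continuous_intros continuous_on_compose2[OF g(1)] bounded_linear.continuous_on[OF i(1)]) auto
    show "(\<lambda>(t, y). (1 - t) *\<^sub>R g (i y) + t *\<^sub>R y) ` ({0..1} \<times> i -` U) \<subseteq> i -` U"
      using seg by (auto simp: iseg)
  qed auto
  moreover have "homotopic_with (\<lambda>_. True) (top_of_set U) (top_of_set U) (i \<circ> g) id"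
  proof (rule homotopic_with_euclideanI[where h="\<lambda>(t, x). (1 - t) *\<^sub>R i (g x) + t *\<^sub>R x"])
    show "continuous_on ({0..1} \<times> U) (\<lambda>(t, x). (1 - t) *\<^sub>R i (g x) + t *\<^sub>R x)"
      unfolding case_prod_unfold
      by (intro continuous_intros bounded_linear.continuous_on[OF i(1)] continuous_on_compose2[OF g(1)]) auto
    show "(\<lambda>(t, x). (1 - t) *\<^sub>R i (g x) + t *\<^sub>R x) ` ({0..1} \<times> U) \<subseteq> U" using seg by auto
  qed auto
  ultimately show ?thesis unfolding homotopy_equivalence_def by blast
qed

text \<open>Only points of \<open>M\<close> and of its preimage are constrained; elsewhere the
  homotopies may move freely, so \<open>\<sigma>\<close> has to reach \<open>M\<close> only near
  \<open>M\<close>.\<close>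

lemma preimage_pair_homotopy_equivalence:
  fixes i :: "'y::banach \<Rightarrow> 'x::banach"
  assumes sep: "separable_space (euclidean :: 'y topology)"
    and i: "bounded_linear i" "closure (range i) = UNIV" and M: "closed M"
    and \<sigma>: "continuous_on UNIV \<sigma>" "\<And>x. x \<in> M \<Longrightarrow> \<sigma> x = 0"
    and A: "open A" "M \<subseteq> A" "\<And>x. x \<in> A \<Longrightarrow> x + i (\<sigma> x) \<in> M"
  shows "homotopy_equivalence_pairs euclidean (i -` M) euclidean M i"
proof -
  have conti: "continuous_on S i" for S by (rule linear_continuous_on[OF i(1)])
  note lini = bounded_linear.linear[OF i(1)]
  \<comment> \<open>For \<open>x\<close> in \<open>M\<close> the segment from \<open>i (g x)\<close>
    to \<open>x\<close> then lies in \<open>A\<close>, where \<open>\<sigma>\<close> leads back to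
    \<open>M\<close>.\<close>
  obtain \<epsilon> :: "'x \<Rightarrow> real" where \<epsilon>: "continuous_on UNIV \<epsilon>" "\<And>x. \<epsilon> x > 0" "\<And>x. x \<in> M \<Longrightarrow> ball x (\<epsilon> x) \<subseteq> A"
    using continuous_radius[OF M A(1,2)] by metis
  obtain g where g: "continuous_on UNIV g" "\<And>x. norm (i (g x) - x) < \<epsilon> x"
    using dense_range_approximation[OF sep i \<epsilon>(1,2)] by (metis UNIV_I)
  define v where "v t x = (1 - t) *\<^sub>R i (g x) + t *\<^sub>R x" for t :: real and x
  define w where "w t y = (1 - t) *\<^sub>R g (i y) + t *\<^sub>R y" for t :: real and y
  define H where "H = (\<lambda>(t, x). v t x + i (\<sigma> (v t x)) - t *\<^sub>R i (\<sigma> x))"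
  define K where "K = (\<lambda>(t, y). w t y + \<sigma> (i (w t y)) - t *\<^sub>R \<sigma> (i y))"
  \<comment> \<open>The last terms of \<open>H\<close> and \<open>K\<close> vanish on \<open>M\<close> and make the end of the homotopy the identity.\<close>
  define G where "G x = g x + \<sigma> (i (g x))" for x
  have iw: "i (w t y) = v t (i y)" for t y
    by (simp add: w_def v_def linear_add[OF lini] linear_scale[OF lini])
  \<comment> \<open>\<open>K\<close> lifts \<open>H\<close> along \<open>i\<close>, so the single
    fact \<open>HM\<close> shows that both homotopies preserve the subspaces.\<close>
  have iK: "i (K (t, y)) = H (t, i y)" for t y
    by (simp add: K_def H_def iw linear_add[OF lini] linear_diff[OF lini] linear_scale[OF lini])
  have iG: "i (G x) = H (0, x)" for x
    by (simp add: G_def H_def v_def linear_add[OF lini])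
  have HM: "H (t, x) \<in> M" if "x \<in> M" "t \<in> {0..1}" for t x
  proof -
    have "dist x (v t x) = norm ((1 - t) *\<^sub>R (i (g x) - x))"
      unfolding dist_norm v_def by (subst norm_minus_commute) (simp add: algebra_simps)
    also have "\<dots> \<le> norm (i (g x) - x)" using that by (simp add: mult_left_le_one_le)
    also have "\<dots> < \<epsilon> x" by (rule g(2))
    finally have "v t x \<in> A" using \<epsilon>(3)[OF that(1)] by auto
    then show ?thesis using A(3) \<sigma>(2)[OF that(1)] by (simp add: H_def linear_0[OF lini])
  qed
  have contG: "continuous_on UNIV G"
    unfolding G_def[abs_def]
    by (intro continuous_intros g(1) continuous_on_compose2[OF \<sigma>(1)] bounded_linear.continuous_on[OF i(1)]) auto
  have contH: "continuous_on ({0..1} \<times> UNIV) H"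
    unfolding H_def v_def case_prod_unfold
    by (intro continuous_intros bounded_linear.continuous_on[OF i(1)] continuous_on_compose2[OF \<sigma>(1)] continuous_on_compose2[OF g(1)]) auto
  have contK: "continuous_on ({0..1} \<times> UNIV) K"
    unfolding K_def w_def case_prod_unfold
    by (intro continuous_intros continuous_on_compose2[OF \<sigma>(1)] continuous_on_compose2[OF g(1)] bounded_linear.continuous_on[OF i(1)]) auto
  have "homotopic_with (\<lambda>h. h ` (i -` M) \<subseteq> i -` M) (top_of_set UNIV) (top_of_set UNIV) (G \<circ> i) id"
    by (rule homotopic_with_euclideanI[OF contK]) (use HM in \<open>auto simp: iK\<close>, auto simp: K_def w_def G_def)
  moreover have "homotopic_with (\<lambda>h. h ` M \<subseteq> M) (top_of_set UNIV) (top_of_set UNIV) (i \<circ> G) id"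
    by (rule homotopic_with_euclideanI[OF contH]) (use HM in \<open>auto simp: iG\<close>, auto simp: H_def v_def)
  moreover have "G ` M \<subseteq> i -` M" using HM by (auto simp: iG)
  ultimately show ?thesis
    using conti contG unfolding homotopy_equivalence_pairs_def by auto
qed

theorem theorem2:
  fixes i :: "'y::banach \<Rightarrow> 'x::banach" and M :: "'x set"
  assumes "separable_space (euclidean :: 'x topology)"
    and "separable_space (euclidean :: 'y topology)"
    and "bounded_linear i" and "inj i" and "closure (range i) = UNIV"
    and "finite_codim_smooth_submanifold M" and "closed M"
  shows "smooth_submanifold (i -` M) \<and> closed (i -` M) \<and>
    homotopy_equivalence (top_of_set (UNIV - i -` M)) (top_of_set (UNIV - M)) i \<and>
    homotopy_equivalence_pairs euclidean (i -` M) euclidean M i"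
proof (intro conjI)
  show "smooth_submanifold (i -` M)"
    using assms by (intro preimage_smooth_submanifold)
  show "closed (i -` M)"
    using assms by (intro continuous_closed_vimage) (auto simp: linear_continuous_at)
  have "open (UNIV - M)" using assms(7) by auto
  from preimage_open_homotopy_equivalence[OF assms(2,3,5) this]
  show "homotopy_equivalence (top_of_set (UNIV - i -` M)) (top_of_set (UNIV - M)) i"
    by (simp add: vimage_Diff)
  obtain \<sigma> :: "'x \<Rightarrow> 'y" and A where "continuous_on UNIV \<sigma>" "\<And>x. x \<in> M \<Longrightarrow> \<sigma> x = 0"
    "open A" "M \<subseteq> A" "\<And>x. x \<in> A \<Longrightarrow> x + i (\<sigma> x) \<in> M"
    using normal_correction[OF assms(1,6,7,3,5)] by metis
  then show "homotopy_equivalence_pairs euclidean (i -` M) euclidean M i"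
    by (rule preimage_pair_homotopy_equivalence[OF assms(2,3,5,7)])
qed

end
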